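(* Let $k\in\{0,1,2,\dots\}$, let $\rho\in\mathbb{C}$, and let $a,b,c\in\mathbb{C}$ be such that $\Re a>0$, $\Re b>0$, $\Re c>0$ and $\Im a=\Im b=\Im c$. Then $$ \int_{-\infty}^\infty {}_1F_1\!\left(\begin{matrix}a+ix\\ 2\Re a\end{matrix};-i\rho\right){}_1F_1\!\left(\begin{matrix}\overline{b}-ix\\ 2\Re b\end{matrix};i\rho\right)\Gamma(a+ix)\Gamma(c+ix)\Gamma(\overline{a}-ix)\Gamma(\overline{c}-ix)\,p_k(x;a,c,\overline{a},\overline{c})\,dx $$ $$ =2\pi\,\frac{\Gamma(2\Re a)\,\Gamma(a+\overline{c})^2\,\Gamma(2\Re c)\,(k+2\Re a+2\Re b-1)_k\,(a+\overline{c})_k\,(2\Re c)_k\,(\rho/4)^k}{k!\,(2k+2\Re a+2\Re c-1)\,\Gamma(2\Re a+2\Re c-1)\,(2\Re b)_k\,\left(\tfrac12(2\Re a+2\Re c-1)\right)_k} $$ $$ \times\ {}_4F_5\!\left(\begin{matrix}\tfrac12(\Re a+\Re b+k),\ \tfrac12(\Re a+\Re b+k+1),\ \Re a+\Re b+k-\tfrac12,\ \Re b-\Re c\\ \Re a+\Re b+\tfrac{k-1}{2},\ \Re a+\Re b+\tfrac{k}{2},\ \Re b+\tfrac{k}{2},\ \Re b+\tfrac{k+1}{2},\ \Re a+\Re c+k+\tfrac12\end{matrix};-\frac{\rho^2}{4}\right). $$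
   Context: The Pochhammer symbol is $(z)_n=\prod_{i=1}^n(z+i-1)$ (so $(z)_0=1$). The generalized hypergeometric function is ${}_pF_q(a_1,\dots,a_p;b_1,\dots,b_q;z)=\sum_{n\ge0}\frac{(a_1)_n\cdots(a_p)_n}{(b_1)_n\cdots(b_q)_n}\frac{z^n}{n!}$. The continuous Hahn polynomials with two pairs of conjugate parameters are, for $a,b\in\mathbb{C}$ with positive real parts, $$p_n(x;a,b,\overline{a},\overline{b})=i^n\frac{(2\Re a)_n(a+\overline{b})_n}{n!}\ {}_3F_2\!\left(\begin{matrix}-n,\ n+2\Re a+2\Re b-1,\ a+ix\\ 2\Re a,\ a+\overline{b}\end{matrix};1\right).$$ Conventions for degenerate parameters: for $k=0$, the numerator parameter $\Re a+\Re b+k-\frac12$ and the denominator parameter $\Re a+\Re b+\frac{k-1}{2}$ of the ${}_4F_5$ coincide and are cancelled (relevant only if $\Re a+\Re b=\frac12$); if $2\Re a+2\Re c=1$, the expression $(2k+T)\,\Gamma(T)\,(T/2)_k$ with $T=2\Re a+2\Re c-1$ is understood as its limit as $T\to0$. *)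

theory Defs
  imports "HOL-Analysis.Analysis"
begin

text \<open>The generalized hypergeometric series with numerator parameters \<open>as\<close> and denominator
  parameters \<open>bs\<close>. It is only meaningful where the series converges and no denominator parameter
  is a non-positive integer (division by zero yields zero in HOL).\<close>

definition hypergeo :: "complex list \<Rightarrow> complex list \<Rightarrow> complex \<Rightarrow> complex" where
  "hypergeo as bs z =
     (\<Sum>n. prod_list (map (\<lambda>a. pochhammer a n) as) / prod_list (map (\<lambda>b. pochhammer b n) bs)
            * (z ^ n / fact n))"

text \<open>The continuous Hahn polynomial with two pairs of conjugate parameters
  \<open>a, b, cnj a, cnj b\<close>; the conjugate parameters are not passed explicitly.\<close>

definition cont_hahn :: "nat \<Rightarrow> complex \<Rightarrow> complex \<Rightarrow> complex \<Rightarrow> complex" where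
  "cont_hahn n x a b =
     \<i> ^ n * (pochhammer (2 * of_real (Re a)) n * pochhammer (a + cnj b) n / fact n)
     * hypergeo [- of_nat n, of_nat n + 2 * of_real (Re a) + 2 * of_real (Re b) - 1, a + \<i> * x]
                [2 * of_real (Re a), a + cnj b] 1"

text \<open>The product \<open>(2k + T) \<Gamma>(T) (T/2)\<^sub>k\<close>. Both \<open>(2k + T) (T/2)\<^sub>k\<close>, which vanishes, and
  \<open>\<Gamma>(T)\<close>, which has a pole, are degenerate at \<open>T = 0\<close>, where the product is replaced by
  its limit.\<close>

definition degen_factor :: "nat \<Rightarrow> complex \<Rightarrow> complex" where
  "degen_factor k T =
     (let f = (\<lambda>t. (2 * of_nat k + t) * Gamma t * pochhammer (t / 2) k)
      in if T = 0 then Lim (at 0) f else f T)"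

text \<open>The \<open>4F5\<close> with \<open>A = Re a\<close>, \<open>B = Re b\<close>, \<open>C = Re c\<close>. For \<open>k = 0\<close> the numerator parameter
  \<open>A + B + k - 1/2\<close> and the denominator parameter \<open>A + B + (k - 1)/2\<close> are equal, and this pair
  is cancelled; both vanish if \<open>A + B = 1/2\<close>.\<close>

definition hypergeo_4F5 :: "nat \<Rightarrow> complex \<Rightarrow> complex \<Rightarrow> complex \<Rightarrow> complex \<Rightarrow> complex" where
  "hypergeo_4F5 k A B C z =
     hypergeo
       ([(A + B + of_nat k) / 2, (A + B + of_nat k + 1) / 2]
        @ (if k = 0 then [] else [A + B + of_nat k - 1/2])
        @ [B - C])
       ((if k = 0 then [] else [A + B + (of_nat k - 1) / 2])
        @ [A + B + of_nat k / 2, B + of_nat k / 2, B + (of_nat k + 1) / 2,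
           A + C + of_nat k + 1/2])
       z"

end

theory Submission
  imports Defs "HOL-Probability.Probability"
begin

text \<open>The product of the two confluent functions is the generating function of the continuous Hahn
  polynomials \<open>p\<^sub>N(x; a, b)\<close>, so the integral is a power series in \<open>\<rho>\<close> whose coefficients pair
  \<open>p\<^sub>N(x; a, b)\<close> with \<open>p\<^sub>k(x; a, c)\<close> under the weight of the latter. After a translation of \<open>x\<close>
  all parameters are real. Expanding the first polynomial in \<open>(a + i x)\<^sub>j\<close> and the second in
  \<open>(c - i x)\<^sub>l\<close>, every term is a Barnes integral; the sum over \<open>l\<close> is Saalschuetzian and the
  remaining sum over \<open>j\<close> is a terminating Watson sum, which vanishes unless \<open>N - k\<close> is even.
  Barnes' first lemma itself is Parseval's identity for two Fourier transforms
  \<open>\<Gamma>(\<alpha> + i x) \<Gamma>(\<gamma> - i x)\<close> of Euler's beta density.\<close>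

section \<open>Terminating hypergeometric sums\<close>

text \<open>Both polynomial families contain the parameter \<open>a\<close>, and this is what makes
  the sum over j summable: the moment of (a + i x)_j contributes (2a)_j, which cancels the same
  factor in the denominator of p_N, while the Saalschuetz sum contributes (-j)_k, which removes
  every j < k. With j = k + l, exactly Watson's pattern of parameters is left. The analytic obstacle
  is the exchange of the series in rho with the integral, because the terms of the confluent series
  grow with x. The weight is therefore split in two: Gamma(a + i x) Gamma(c - i x) is spent on
  making the terms bounded uniformly in x, with bounds summable in N; the other two Gamma factors
  times p_k form an integrable majorant. The hypotheses admit Re a + Re b = 1/2 and Re a + Re c =
  1/2, where factors such as 2s - 1 or Gamma(T) degenerate. Hence the separate treatment of index 0
  in several places, and the rewriting of the degenerate factor by the duplication formula into an
  expression regular at T = 0.\<close>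

lemma pochhammer_reflect:
  fixes z :: "'a::comm_ring_1"
  shows "pochhammer z n = (-1) ^ n * pochhammer (1 - z - of_nat n) n"
  using pochhammer_minus'[of "-z" n] pochhammer_minus[of "-z" n] by (simp add: algebra_simps)

text \<open>Chu-Vandermonde, 2F1(-n, y; s; 1) = (s - y)_n / (s)_n, multiplied by (s)_n so that it
  holds in every commutative ring. Reflection turns the left side into the Pochhammer symbol of a
  sum, to which the binomial theorem for rising factorials applies.\<close>

lemma pochhammer_diff_sum:
  fixes s y :: "'a::comm_ring_1"
  shows "pochhammer (s - y) n =
    (\<Sum>i\<le>n. of_nat (n choose i) * (-1) ^ i * pochhammer y i * pochhammer (s + of_nat i) (n - i))"
proof -
  have "pochhammer (s - y) n = (-1) ^ n * pochhammer (y + (1 - s - of_nat n)) n"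
    by (subst pochhammer_reflect) (simp add: algebra_simps)
  also have "\<dots> = (\<Sum>i\<le>n. (-1) ^ n * (of_nat (n choose i) * pochhammer y i
                      * pochhammer (1 - s - of_nat n) (n - i)))"
    by (simp only: pochhammer_binomial_sum sum_distrib_left)
  also have "\<dots> = (\<Sum>i\<le>n. of_nat (n choose i) * (-1) ^ i * pochhammer y i * pochhammer (s + of_nat i) (n - i))"
  proof (rule sum.cong[OF refl])
    fix i assume "i \<in> {..n}"
    then have i: "i \<le> n" by simp
    have "(-1) ^ n = (-1) ^ i * ((-1) ^ (n - i) :: 'a)"
      using i by (simp flip: power_add)
    moreover have "pochhammer (s + of_nat i) (n - i)
        = (-1) ^ (n - i) * pochhammer (1 - s - of_nat n) (n - i)"
      by (subst pochhammer_reflect) (use i in \<open>simp add: of_nat_diff algebra_simps\<close>)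
    ultimately show "(-1) ^ n * (of_nat (n choose i) * pochhammer y i * pochhammer (1 - s - of_nat n) (n - i))
        = of_nat (n choose i) * (-1) ^ i * pochhammer y i * pochhammer (s + of_nat i) (n - i)"
      by (simp add: algebra_simps)
  qed
  finally show ?thesis .
qed

lemma sum_atMost_triangle_swap:
  fixes f :: "nat \<Rightarrow> nat \<Rightarrow> 'a::comm_monoid_add"
  shows "(\<Sum>m\<le>n. \<Sum>i\<le>n - m. f m (m + i)) = (\<Sum>j\<le>n. \<Sum>m\<le>j. f m j)"
proof -
  have "(\<Sum>m\<le>n. \<Sum>i\<le>n - m. f m (m + i)) = (\<Sum>m\<le>n. \<Sum>j\<in>{m..n}. f m j)"
    by (intro sum.cong refl sum.reindex_bij_witness[of _ "\<lambda>j. j - m" "\<lambda>i. m + i" for m]) auto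
  also have "\<dots> = (\<Sum>(m, j) \<in> (SIGMA m:{..n}. {m..n}). f m j)"
    by (simp add: sum.Sigma)
  also have "\<dots> = (\<Sum>(j, m) \<in> (SIGMA j:{..n}. {..j}). f m j)"
    by (rule sum.reindex_bij_witness[of _ "\<lambda>(j, m). (m, j)" "\<lambda>(m, j). (j, m)"]) auto
  also have "\<dots> = (\<Sum>j\<le>n. \<Sum>m\<le>j. f m j)"
    by (simp add: sum.Sigma)
  finally show ?thesis .
qed

text \<open>Shifting both s and y by m leaves s - y unchanged, and (y)_m absorbs (y + m)_i. A mixed
  product thus becomes a combination of single symbols (y)_j, which is the first move in both double
  sums below.\<close>

lemma pochhammer_mult_pochhammer_diff_sum:
  fixes s y :: "'a::comm_ring_1"
  assumes "m \<le> n"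
  shows "pochhammer y m * pochhammer (s - y) (n - m) =
    (\<Sum>i\<le>n - m. of_nat ((n - m) choose i) * (-1) ^ i * pochhammer y (m + i)
       * pochhammer (s + of_nat (m + i)) (n - (m + i)))"
proof -
  have "pochhammer (s - y) (n - m) = pochhammer ((s + of_nat m) - (y + of_nat m)) (n - m)"
    by simp
  also have "\<dots> = (\<Sum>i\<le>n - m. of_nat ((n - m) choose i) * (-1) ^ i * pochhammer (y + of_nat m) i
       * pochhammer (s + of_nat m + of_nat i) (n - m - i))"
    by (rule pochhammer_diff_sum)
  finally show ?thesis
    by (simp add: sum_distrib_left pochhammer_product'[of y m] mult_ac add.assoc)
qed

text \<open>The Pfaff-Saalschuetz theorem with denominators cleared, by three uses of
  Chu-Vandermonde: the factors (b)_l and (d - a - b)_(n-l) are expanded in (b)_j; after exchanging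
  the sums, the sum over l gives (d - a)_j and the sum over j gives (d - b)_n.\<close>

lemma saalschuetz_polynomial:
  fixes a b d :: "'a::comm_ring_1"
  shows "(\<Sum>l\<le>n. of_nat (n choose l) * pochhammer a l * pochhammer b l
            * pochhammer (d + of_nat l) (n - l) * pochhammer (d - a - b) (n - l))
         = pochhammer (d - a) n * pochhammer (d - b) n"
proof -
  define P where "P = (\<lambda>l j. of_nat (n choose j) * of_nat (j choose l) * (-1) ^ (j - l)
       * pochhammer a l * pochhammer (d + of_nat l) (n - l)
       * pochhammer b j * pochhammer (d - a + of_nat j) (n - j))"
  have "(\<Sum>l\<le>n. of_nat (n choose l) * pochhammer a l * pochhammer b l
            * pochhammer (d + of_nat l) (n - l) * pochhammer (d - a - b) (n - l))
        = (\<Sum>l\<le>n. \<Sum>i\<le>n - l. P l (l + i))"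
  proof (rule sum.cong[OF refl])
    fix l assume "l \<in> {..n}"
    then have l: "l \<le> n" by simp
    have ch: "(of_nat (n choose l) * of_nat ((n - l) choose i) :: 'a)
        = of_nat (n choose (l + i)) * of_nat ((l + i) choose l)" if "i \<le> n - l" for i
      using choose_mult[of l "l + i" n] l that by (simp flip: of_nat_mult)
    have "of_nat (n choose l) * pochhammer a l * pochhammer b l
            * pochhammer (d + of_nat l) (n - l) * pochhammer (d - a - b) (n - l)
        = (\<Sum>i\<le>n - l. (of_nat (n choose l) * of_nat ((n - l) choose i)) * (-1) ^ i
            * pochhammer a l * pochhammer (d + of_nat l) (n - l) * pochhammer b (l + i)
            * pochhammer (d - a + of_nat (l + i)) (n - (l + i)))"
      using arg_cong[OF pochhammer_mult_pochhammer_diff_sum[OF l, of b "d - a"],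
          of "\<lambda>z. of_nat (n choose l) * pochhammer a l * pochhammer (d + of_nat l) (n - l) * z"]
      by (simp add: sum_distrib_left mult_ac)
    also have "\<dots> = (\<Sum>i\<le>n - l. P l (l + i))"
      by (intro sum.cong refl) (simp add: P_def ch)
    finally show "of_nat (n choose l) * pochhammer a l * pochhammer b l
            * pochhammer (d + of_nat l) (n - l) * pochhammer (d - a - b) (n - l)
        = (\<Sum>i\<le>n - l. P l (l + i))" .
  qed
  also have "\<dots> = (\<Sum>j\<le>n. \<Sum>l\<le>j. P l j)"
    by (rule sum_atMost_triangle_swap)
  also have "\<dots> = (\<Sum>j\<le>n. pochhammer (d - a) n
        * (of_nat (n choose j) * (-1) ^ j * pochhammer b j * pochhammer (d + of_nat j) (n - j)))"
  proof (rule sum.cong[OF refl])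
    fix j assume "j \<in> {..n}"
    then have j: "j \<le> n" by simp
    have "(\<Sum>l\<le>j. P l j) = (\<Sum>l\<le>j. of_nat (n choose j) * (-1) ^ j * pochhammer b j
          * pochhammer (d - a + of_nat j) (n - j) * pochhammer (d + of_nat j) (n - j)
          * (of_nat (j choose l) * (-1) ^ l * pochhammer a l * pochhammer (d + of_nat l) (j - l)))"
    proof (rule sum.cong[OF refl])
      fix l assume "l \<in> {..j}"
      then have l: "l \<le> j" by simp
      have "pochhammer (d + of_nat l) (n - l) = pochhammer (d + of_nat l) (j - l) * pochhammer (d + of_nat j) (n - j)"
        using pochhammer_product[of "j - l" "n - l" "d + of_nat l"] l j
        by (simp add: of_nat_diff algebra_simps)
      moreover have "(-1) ^ (j - l) = ((-1) ^ j * (-1) ^ l :: 'a)"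
        using l by (simp add: power_diff_conv_inverse uminus_power_if)
      ultimately show "P l j = of_nat (n choose j) * (-1) ^ j * pochhammer b j
          * pochhammer (d - a + of_nat j) (n - j) * pochhammer (d + of_nat j) (n - j)
          * (of_nat (j choose l) * (-1) ^ l * pochhammer a l * pochhammer (d + of_nat l) (j - l))"
        by (simp add: P_def algebra_simps)
    qed
    also have "\<dots> = of_nat (n choose j) * (-1) ^ j * pochhammer b j
          * pochhammer (d - a + of_nat j) (n - j) * pochhammer (d + of_nat j) (n - j)
          * pochhammer (d - a) j"
      by (simp only: pochhammer_diff_sum[of d a j] sum_distrib_left)
    also have "\<dots> = pochhammer (d - a) n
        * (of_nat (n choose j) * (-1) ^ j * pochhammer b j * pochhammer (d + of_nat j) (n - j))"
      using pochhammer_product[OF j, of "d - a"] by (simp add: algebra_simps)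
    finally show "(\<Sum>l\<le>j. P l j) = pochhammer (d - a) n
        * (of_nat (n choose j) * (-1) ^ j * pochhammer b j * pochhammer (d + of_nat j) (n - j))" .
  qed
  also have "\<dots> = pochhammer (d - a) n * pochhammer (d - b) n"
    by (simp only: pochhammer_diff_sum[of d b n] sum_distrib_left)
  finally show ?thesis .
qed


lemma pochhammer_minus_of_nat:
  "pochhammer (- of_nat n) k = ((-1) ^ k * fact k * of_nat (n choose k) :: 'a::field_char_0)"
  unfolding binomial_gbinomial gbinomial_pochhammer by simp

lemma pochhammer_nonzero:
  fixes z :: "'a::field_char_0"
  assumes "z \<notin> \<int>\<^sub>\<le>\<^sub>0"
  shows "pochhammer z n \<noteq> 0" "z + of_nat n \<noteq> 0"
proof -
  show "z + of_nat n \<noteq> 0"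
    using assms by (metis add_eq_0_iff2 minus_of_nat_in_nonpos_Ints)
  show "pochhammer z n \<noteq> 0"
    using assms by (auto simp: pochhammer_eq_0_iff)
qed

lemma add_of_nat_notin_nonpos_Ints:
  fixes z :: "'a::field_char_0"
  assumes "z \<notin> \<int>\<^sub>\<le>\<^sub>0"
  shows "z + of_nat n \<notin> \<int>\<^sub>\<le>\<^sub>0"
proof
  assume "z + of_nat n \<in> \<int>\<^sub>\<le>\<^sub>0"
  then obtain k where "z + of_nat n = - of_nat k"
    by (elim nonpos_Ints_cases')
  then have "z = - of_nat (n + k)"
    by (simp add: algebra_simps eq_diff_eq)
  with assms show False
    using minus_of_nat_in_nonpos_Ints by metis
qed

text \<open>The balanced series 3F2(-k, k + \<sigma> - 1, \<tau> + j; \<tau>, \<sigma> + j; 1). The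
  factor (-j)_k on the right vanishes for j < k; later this is the orthogonality of p_k to
  polynomials of lower degree.\<close>

lemma saalschuetz:
  fixes \<sigma> \<tau> :: "'a::field_char_0"
  assumes \<tau>: "\<tau> \<notin> \<int>\<^sub>\<le>\<^sub>0" and \<sigma>: "\<sigma> \<notin> \<int>\<^sub>\<le>\<^sub>0"
  shows "(\<Sum>l\<le>k. of_nat (k choose l) * (-1) ^ l * pochhammer (of_nat k + \<sigma> - 1) l
            * pochhammer (\<tau> + of_nat j) l / (pochhammer \<tau> l * pochhammer (\<sigma> + of_nat j) l))
         = pochhammer (- of_nat j) k * pochhammer (\<sigma> - \<tau>) k
            / (pochhammer \<tau> k * pochhammer (\<sigma> + of_nat j) k)"
proof -
  have \<sigma>j: "\<sigma> + of_nat j \<notin> \<int>\<^sub>\<le>\<^sub>0"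
    using \<sigma> by (rule add_of_nat_notin_nonpos_Ints)
  note nz = pochhammer_nonzero(1)[OF \<tau>] pochhammer_nonzero(1)[OF \<sigma>j]
  define a b where "a = of_nat k + \<sigma> - 1" and "b = \<tau> + of_nat j"
  \<comment> \<open>This is the balance condition: the argument is the reflection of \<sigma> + j,
    so reflecting its Pochhammer symbol produces the denominator with \<sigma> + j.\<close>
  have e: "\<tau> - a - b = 1 - (\<sigma> + of_nat j) - of_nat k" by (simp add: a_def b_def)
  have "pochhammer \<tau> k * pochhammer (\<sigma> + of_nat j) k *
      (\<Sum>l\<le>k. of_nat (k choose l) * (-1) ^ l * pochhammer a l
            * pochhammer b l / (pochhammer \<tau> l * pochhammer (\<sigma> + of_nat j) l))
      = (\<Sum>l\<le>k. (-1) ^ k * (of_nat (k choose l) * pochhammer a l * pochhammer b l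
            * pochhammer (\<tau> + of_nat l) (k - l) * pochhammer (\<tau> - a - b) (k - l)))"
    unfolding sum_distrib_left
  proof (rule sum.cong[OF refl])
    fix l assume "l \<in> {..k}"
    then have l: "l \<le> k" by simp
    have 1: "pochhammer (\<sigma> + of_nat j) k = pochhammer (\<sigma> + of_nat j) l
        * ((-1) ^ (k - l) * pochhammer (\<tau> - a - b) (k - l))"
      using pochhammer_product[OF l, of "\<sigma> + of_nat j"]
        pochhammer_reflect[of "\<sigma> + of_nat j + of_nat l" "k - l"] l
      unfolding e by (simp add: of_nat_diff algebra_simps)
    have 2: "(-1) ^ k = (-1) ^ l * ((-1) ^ (k - l) :: 'a)"
      using l by (simp flip: power_add)
    show "pochhammer \<tau> k * pochhammer (\<sigma> + of_nat j) k * (of_nat (k choose l) * (-1) ^ l * pochhammer a l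
            * pochhammer b l / (pochhammer \<tau> l * pochhammer (\<sigma> + of_nat j) l))
      = (-1) ^ k * (of_nat (k choose l) * pochhammer a l * pochhammer b l
            * pochhammer (\<tau> + of_nat l) (k - l) * pochhammer (\<tau> - a - b) (k - l))"
      unfolding 1 2 pochhammer_product[OF l, of \<tau>] using nz by (simp add: field_simps)
  qed
  also have "\<dots> = (-1) ^ k * (pochhammer (\<tau> - a) k * pochhammer (\<tau> - b) k)"
    by (simp only: saalschuetz_polynomial flip: sum_distrib_left)
  also have "\<dots> = pochhammer (- of_nat j) k * pochhammer (\<sigma> - \<tau>) k"
    by (subst (2) pochhammer_reflect) (simp add: a_def b_def algebra_simps)
  finally show ?thesis
    using nz unfolding a_def b_def by (simp add: field_simps)
qed

text \<open>For y = a + i x and s - y = b - i x the left side is, up to a power of i, the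
  coefficient in the Cauchy product of the two confluent series; the right side is a continuous Hahn
  polynomial in its 3F2 form. Once everything is expanded in (y)_j, the sum over m for fixed j is a
  Chu-Vandermonde sum.\<close>

lemma convolution_sum_transform:
  fixes s u v y :: "'a::field_char_0"
  assumes u: "u \<notin> \<int>\<^sub>\<le>\<^sub>0" and v: "v \<notin> \<int>\<^sub>\<le>\<^sub>0" and s: "s \<notin> \<int>\<^sub>\<le>\<^sub>0"
  shows "(\<Sum>m\<le>N. (-1) ^ m * pochhammer y m * pochhammer (s - y) (N - m)
            / (fact m * pochhammer u m * fact (N - m) * pochhammer v (N - m)))
    = pochhammer s N / (fact N * pochhammer v N) *
      (\<Sum>j\<le>N. of_nat (N choose j) * (-1) ^ j * pochhammer (of_nat N + u + v - 1) j * pochhammer y j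
          / (pochhammer u j * pochhammer s j))"
proof -
  note nz = pochhammer_nonzero(1)[OF u] pochhammer_nonzero(1)[OF v] pochhammer_nonzero(1)[OF s]
  define P where "P = (\<lambda>m j. (-1) ^ j * pochhammer y j * pochhammer (s + of_nat j) (N - j) / fact (N - j)
       / (fact m * fact (j - m) * pochhammer u m * pochhammer v (N - m)))"
  \<comment> \<open>Reflecting the tail of (v)_N moves (v)_(N-m) from the denominator to the
    numerator as (1 - v - N)_m, which plays the role of y in Chu-Vandermonde.\<close>
  have inner: "(\<Sum>m\<le>j. of_nat (j choose m) / (pochhammer u m * pochhammer v (N - m)))
      = pochhammer (of_nat N + u + v - 1) j / (pochhammer u j * pochhammer v N)" if j: "j \<le> N" for j
  proof -
    have "pochhammer u j * pochhammer v N * (\<Sum>m\<le>j. of_nat (j choose m) / (pochhammer u m * pochhammer v (N - m)))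
       = (\<Sum>m\<le>j. of_nat (j choose m) * (-1) ^ m * pochhammer (1 - v - of_nat N) m
            * pochhammer (u + of_nat m) (j - m))"
      unfolding sum_distrib_left
    proof (rule sum.cong[OF refl])
      fix m assume "m \<in> {..j}"
      then have m: "m \<le> j" by simp
      have 1: "pochhammer v N = pochhammer v (N - m) * ((-1) ^ m * pochhammer (1 - v - of_nat N) m)"
        using pochhammer_product[of "N - m" N v] pochhammer_reflect[of "v + of_nat (N - m)" m] m j
        by (simp add: of_nat_diff algebra_simps)
      show "pochhammer u j * pochhammer v N * (of_nat (j choose m) / (pochhammer u m * pochhammer v (N - m)))
        = of_nat (j choose m) * (-1) ^ m * pochhammer (1 - v - of_nat N) m
            * pochhammer (u + of_nat m) (j - m)"
        unfolding 1 pochhammer_product[OF m, of u] using nz by (simp add: field_simps)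
    qed
    also have "\<dots> = pochhammer (of_nat N + u + v - 1) j"
      by (subst pochhammer_diff_sum[symmetric]) (simp add: algebra_simps)
    finally show ?thesis using nz by (simp add: field_simps)
  qed
  have "(\<Sum>m\<le>N. (-1) ^ m * pochhammer y m * pochhammer (s - y) (N - m)
            / (fact m * pochhammer u m * fact (N - m) * pochhammer v (N - m)))
        = (\<Sum>m\<le>N. \<Sum>i\<le>N - m. P m (m + i))"
  proof (rule sum.cong[OF refl])
    fix m assume "m \<in> {..N}"
    then have m: "m \<le> N" by simp
    have "(-1) ^ m * pochhammer y m * pochhammer (s - y) (N - m)
            / (fact m * pochhammer u m * fact (N - m) * pochhammer v (N - m))
        = (-1) ^ m / (fact m * pochhammer u m * fact (N - m) * pochhammer v (N - m))
           * (pochhammer y m * pochhammer (s - y) (N - m))" by simp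
    also have "\<dots> = (\<Sum>i\<le>N - m. P m (m + i))"
      unfolding pochhammer_mult_pochhammer_diff_sum[OF m] sum_distrib_left
    proof (rule sum.cong[OF refl])
      fix i assume "i \<in> {..N - m}"
      then have i: "i \<le> N - m" by simp
      have ch: "of_nat ((N - m) choose i) = (fact (N - m) / (fact i * fact (N - (m + i))) :: 'a)"
        using i by (simp add: binomial_fact)
      show "(-1) ^ m / (fact m * pochhammer u m * fact (N - m) * pochhammer v (N - m)) *
          (of_nat ((N - m) choose i) * (-1) ^ i * pochhammer y (m + i)
           * pochhammer (s + of_nat (m + i)) (N - (m + i))) = P m (m + i)"
        unfolding ch P_def by (simp add: power_add mult_ac)
    qed
    finally show "(-1) ^ m * pochhammer y m * pochhammer (s - y) (N - m)
            / (fact m * pochhammer u m * fact (N - m) * pochhammer v (N - m))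
        = (\<Sum>i\<le>N - m. P m (m + i))" .
  qed
  also have "\<dots> = (\<Sum>j\<le>N. \<Sum>m\<le>j. P m j)"
    by (rule sum_atMost_triangle_swap)
  also have "\<dots> = pochhammer s N / (fact N * pochhammer v N) *
      (\<Sum>j\<le>N. of_nat (N choose j) * (-1) ^ j * pochhammer (of_nat N + u + v - 1) j * pochhammer y j
          / (pochhammer u j * pochhammer s j))"
    unfolding sum_distrib_left
  proof (rule sum.cong[OF refl])
    fix j assume "j \<in> {..N}"
    then have j: "j \<le> N" by simp
    have "(\<Sum>m\<le>j. P m j) = (\<Sum>m\<le>j. (-1) ^ j * pochhammer y j * pochhammer (s + of_nat j) (N - j) / fact (N - j) / fact j
        * (of_nat (j choose m) / (pochhammer u m * pochhammer v (N - m))))"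
      by (intro sum.cong refl) (simp add: P_def binomial_fact)
    also have "\<dots> = (-1) ^ j * pochhammer y j * pochhammer (s + of_nat j) (N - j) / fact (N - j) / fact j
        * (pochhammer (of_nat N + u + v - 1) j / (pochhammer u j * pochhammer v N))"
      by (simp only: inner[OF j] flip: sum_distrib_left)
    also have "\<dots> = pochhammer s N / (fact N * pochhammer v N) *
        (of_nat (N choose j) * (-1) ^ j * pochhammer (of_nat N + u + v - 1) j * pochhammer y j
          / (pochhammer u j * pochhammer s j))"
      using nz pochhammer_product[OF j, of s] j by (simp add: binomial_fact mult_ac)
    finally show "(\<Sum>m\<le>j. P m j) = pochhammer s N / (fact N * pochhammer v N) *
        (of_nat (N choose j) * (-1) ^ j * pochhammer (of_nat N + u + v - 1) j * pochhammer y j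
          / (pochhammer u j * pochhammer s j))" .
  qed
  finally show ?thesis .
qed

text \<open>Watson's 3F2(A, B, C; (A + B + 1)/2, 2C; 1) in the terminating case A = -n, B = n + 2s -
  1, C = g.\<close>

definition watson_sum :: "'a::field_char_0 \<Rightarrow> 'a \<Rightarrow> nat \<Rightarrow> 'a" where
  "watson_sum s g n = (\<Sum>l\<le>n. of_nat (n choose l) * (-1) ^ l * pochhammer (of_nat n + 2 * s - 1) l
     * pochhammer g l / (pochhammer s l * pochhammer (2 * g) l))"

text \<open>Zeilberger's algorithm: \<open>G\<close> is the certificate. For \<open>n = 0\<close> the argument would divide by
  \<open>2 * s - 1\<close>, which may vanish.\<close>

lemma watson_sum_rec:
  fixes s g :: "'a::field_char_0"
  assumes s: "2 * s \<notin> \<int>\<^sub>\<le>\<^sub>0" "s \<notin> \<int>\<^sub>\<le>\<^sub>0" and g: "2 * g \<notin> \<int>\<^sub>\<le>\<^sub>0" and n: "n > 0"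
  shows "(2 * g + of_nat n + 1) * (of_nat n + 2 * s) * watson_sum s g (n + 2)
    = (2 * s + of_nat n - 2 * g) * (of_nat n + 1) * watson_sum s g n"
proof -
  define nn :: 'a where "nn = of_nat n"
  note nz = pochhammer_nonzero[OF s(1)] pochhammer_nonzero[OF s(2)] pochhammer_nonzero[OF g]
  define F where "F = (\<lambda>n l. pochhammer (- of_nat n) l * pochhammer (of_nat n + 2 * s - 1) l
     * pochhammer g l / (pochhammer s l * pochhammer (2 * g) l * fact l))"
  \<comment> \<open>\<open>T\<close> takes its first parameter from \<open>F (n + 2)\<close> and its
    second from \<open>F n\<close>. Up to factors free of l, both are then polynomial multiples of
    \<open>T\<close>, and the recurrence becomes a polynomial identity in l.\<close>
  define T where "T = (\<lambda>l. pochhammer (- of_nat (n + 2)) l * pochhammer (of_nat n + 2 * s - 1) l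
     * pochhammer g l / (pochhammer s l * pochhammer (2 * g) l * fact l))"
  define G where "G = (\<lambda>l. T l * of_nat l * (s + of_nat l - 1) * (2 * g + of_nat l - 1))"
  have W: "watson_sum s g m = (\<Sum>l\<le>M. F m l)" if "m \<le> M" for m M
  proof -
    have "watson_sum s g m = (\<Sum>l\<le>m. F m l)"
      unfolding watson_sum_def by (intro sum.cong refl) (simp add: F_def pochhammer_minus_of_nat)
    also have "\<dots> = (\<Sum>l\<le>M. F m l)"
      by (rule sum.mono_neutral_left) (use that in \<open>auto simp: F_def pochhammer_minus_of_nat\<close>)
    finally show ?thesis .
  qed
  have F0: "(nn + 1) * (nn + 2) * F n l = T l * (nn + 2 - of_nat l) * (nn + 1 - of_nat l)" for l
  proof -
    have "(nn + 1) * (nn + 2) * pochhammer (- nn) l = pochhammer (- nn - 2) (Suc (Suc l))"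
      unfolding pochhammer_rec by (simp add: algebra_simps)
    also have "\<dots> = pochhammer (- of_nat (n + 2)) l * (nn + 2 - of_nat l) * (nn + 1 - of_nat l)"
      unfolding pochhammer_Suc by (simp add: algebra_simps nn_def)
    finally have *: "(nn + 1) * (nn + 2) * pochhammer (- nn) l
      = pochhammer (- of_nat (n + 2)) l * (nn + 2 - of_nat l) * (nn + 1 - of_nat l)" .
    show ?thesis using arg_cong[OF *, of "\<lambda>z. z * pochhammer (of_nat n + 2 * s - 1) l
     * pochhammer g l / (pochhammer s l * pochhammer (2 * g) l * fact l)"]
      by (simp add: F_def T_def nn_def mult_ac)
  qed
  have F2: "(nn + 2 * s - 1) * (nn + 2 * s) * F (n + 2) l
      = T l * (nn + 2 * s - 1 + of_nat l) * (nn + 2 * s + of_nat l)" for l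
  proof -
    have "(nn + 2 * s - 1) * (nn + 2 * s) * pochhammer (of_nat (n + 2) + 2 * s - 1) l
        = pochhammer (nn + 2 * s - 1) (Suc (Suc l))"
      unfolding pochhammer_rec by (simp add: algebra_simps nn_def)
    also have "\<dots> = pochhammer (of_nat n + 2 * s - 1) l * (nn + 2 * s - 1 + of_nat l) * (nn + 2 * s + of_nat l)"
      unfolding pochhammer_Suc by (simp add: algebra_simps nn_def)
    finally have *: "(nn + 2 * s - 1) * (nn + 2 * s) * pochhammer (of_nat (n + 2) + 2 * s - 1) l
      = pochhammer (of_nat n + 2 * s - 1) l * (nn + 2 * s - 1 + of_nat l) * (nn + 2 * s + of_nat l)" .
    show ?thesis using arg_cong[OF *, of "\<lambda>z. z * pochhammer (- of_nat (n + 2)) l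
     * pochhammer g l / (pochhammer s l * pochhammer (2 * g) l * fact l)"]
      by (simp add: F_def T_def mult_ac)
  qed
  have G: "G (Suc l) = T l * (of_nat l - nn - 2) * (nn + 2 * s - 1 + of_nat l) * (g + of_nat l)" for l
    using nz(4)[of l] nz(6)[of l] of_nat_neq_0[of l, where 'a = 'a]
    unfolding G_def T_def pochhammer_Suc nn_def
    by (simp add: divide_simps del: of_nat_Suc) (simp add: algebra_simps)?
  have key: "(nn + 2) * (nn + 2 * s - 1) * (- (2 * g + nn + 1) * (nn + 2 * s) * F (n + 2) l
      + (2 * s + nn - 2 * g) * (nn + 1) * F n l)
     = 2 * (2 * nn + 2 * s + 1) * (G (Suc l) - G l)" for l
  proof -
    have "(nn + 2) * (nn + 2 * s - 1) * (- (2 * g + nn + 1) * (nn + 2 * s) * F (n + 2) l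
      + (2 * s + nn - 2 * g) * (nn + 1) * F n l)
      = - (nn + 2) * (2 * g + nn + 1) * ((nn + 2 * s - 1) * (nn + 2 * s) * F (n + 2) l)
       + (nn + 2 * s - 1) * (2 * s + nn - 2 * g) * ((nn + 1) * (nn + 2) * F n l)"
      by (simp add: algebra_simps)
    also have "\<dots> = 2 * (2 * nn + 2 * s + 1) * (G (Suc l) - G l)"
      unfolding F0 F2 G by (simp add: G_def algebra_simps)
    finally show ?thesis .
  qed
  \<comment> \<open>Both ends of the telescoping sum vanish: \<open>G 0\<close> through its factor
    l, and \<open>G (n + 3)\<close> through the factor l - n - 2 at l = n + 2.\<close>
  have "(\<Sum>l\<le>n + 2. G (Suc l) - G l) = G (Suc (n + 2)) - G 0"
    by (simp only: sum_lessThan_telescope flip: lessThan_Suc_atMost)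
  also have "\<dots> = 0"
    unfolding G by (simp add: G_def nn_def)
  finally have "(\<Sum>l\<le>n + 2. 2 * (2 * nn + 2 * s + 1) * (G (Suc l) - G l)) = 0"
    by (simp flip: sum_distrib_left)
  moreover have "(nn + 2) * (nn + 2 * s - 1) * (- (2 * g + nn + 1) * (nn + 2 * s) * watson_sum s g (n + 2)
      + (2 * s + nn - 2 * g) * (nn + 1) * watson_sum s g n)
      = (\<Sum>l\<le>n + 2. 2 * (2 * nn + 2 * s + 1) * (G (Suc l) - G l))"
    unfolding key[symmetric] W[of "n + 2" "n + 2", OF le_refl] W[of n "n + 2", OF le_add1]
    by (simp only: sum_distrib_left distrib_left sum.distrib mult.assoc)
  ultimately have "(nn + 2) * (nn + 2 * s - 1) * (- (2 * g + nn + 1) * (nn + 2 * s) * watson_sum s g (n + 2)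
      + (2 * s + nn - 2 * g) * (nn + 1) * watson_sum s g n) = 0"
    by simp
  moreover have "nn + 2 \<noteq> 0"
    unfolding nn_def by (metis of_nat_add of_nat_eq_0_iff of_nat_numeral add_is_0 zero_neq_numeral)
  moreover have "nn + 2 * s - 1 \<noteq> 0"
    using nz(2)[of "n - 1"] n unfolding nn_def by (simp add: of_nat_diff algebra_simps)
  ultimately have "- (2 * g + nn + 1) * (nn + 2 * s) * watson_sum s g (n + 2)
      + (2 * s + nn - 2 * g) * (nn + 1) * watson_sum s g n = 0"
    by (metis mult_eq_0_iff)
  then show ?thesis
    by (simp add: nn_def algebra_simps add_eq_0_iff)
qed

lemma watson_sum_odd_even:
  fixes s g :: "'a::field_char_0"
  assumes s: "2 * s \<notin> \<int>\<^sub>\<le>\<^sub>0" "s \<notin> \<int>\<^sub>\<le>\<^sub>0" and g: "2 * g \<notin> \<int>\<^sub>\<le>\<^sub>0"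
  shows "watson_sum s g (2 * j + 1) = 0"
    and "watson_sum s g (2 * j) = pochhammer (1/2) j * pochhammer (s - g) j
           / (pochhammer s j * pochhammer (g + 1/2) j)"
proof -
  have s0: "s \<noteq> 0" and s1: "s + 1 \<noteq> 0" and s2: "2 * s + 1 \<noteq> 0"
    and g0: "g \<noteq> 0" and g1: "2 * g + 1 \<noteq> 0" and g2: "2 + g * 4 \<noteq> 0"
    using pochhammer_nonzero(2)[OF s(1), of 1] pochhammer_nonzero(2)[OF s(2), of 0]
      pochhammer_nonzero(2)[OF s(2), of 1] pochhammer_nonzero(2)[OF g, of 0] pochhammer_nonzero(2)[OF g, of 1]
      mult_eq_0_iff[of 2 "2 * g + 1"]
    by (auto simp: algebra_simps)
  show "watson_sum s g (2 * j + 1) = 0"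
  proof (induction j)
    case 0
    \<comment> \<open>The sum for n = 1 is 1 - 2 s g / (s * 2 g) = 0.\<close>
    show ?case using s0 g0 by (simp add: watson_sum_def)
  next
    case (Suc j)
    have "2 * g + of_nat (2 * j + 1) + 1 \<noteq> 0"
      using pochhammer_nonzero(2)[OF g, of "2 * j + 2"] by (simp add: algebra_simps)
    moreover have "of_nat (2 * j + 1) + 2 * s \<noteq> 0"
      using pochhammer_nonzero(2)[OF s(1), of "2 * j + 1"] by (simp add: algebra_simps)
    ultimately show ?case
      using watson_sum_rec[OF s g, of "2 * j + 1"] Suc by simp
  qed
  show "watson_sum s g (2 * j) = pochhammer (1/2) j * pochhammer (s - g) j
           / (pochhammer s j * pochhammer (g + 1/2) j)"
  proof (induction j)
    case 0
    show ?case by (simp add: watson_sum_def)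
  next
    case (Suc j)
    have ne: "2 * g + of_nat (2 * j) + 1 \<noteq> 0" "of_nat (2 * j) + 2 * s \<noteq> 0"
      using pochhammer_nonzero(2)[OF g, of "2 * j + 1"] pochhammer_nonzero(2)[OF s(1), of "2 * j"]
      by (simp_all add: algebra_simps)
    have "(2 * g + of_nat (2 * j) + 1) * (of_nat (2 * j) + 2 * s) * watson_sum s g (2 * j + 2)
        = (2 * s + of_nat (2 * j) - 2 * g) * (of_nat (2 * j) + 1) * watson_sum s g (2 * j)"
    \<comment> \<open>The recurrence is available only for n > 0, so the step from n = 0 to n = 2 is
      checked by direct evaluation.\<close>
    proof (cases "j = 0")
      case True
      then show ?thesis
        using s0 s1 s2 g0 g1 g2 by (simp add: watson_sum_def numeral_2_eq_2 pochhammer_Suc divide_simps)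
          (simp add: algebra_simps)
    next
      case False
      then show ?thesis using watson_sum_rec[OF s g, of "2 * j"] by simp
    qed
    moreover have "w' = A / D * w" if "D * w' = A * w" "D \<noteq> 0" for w w' A D :: 'a
      using that by (simp add: field_simps)
    ultimately have "watson_sum s g (2 * Suc j)
       = (2 * s + of_nat (2 * j) - 2 * g) * (of_nat (2 * j) + 1) /
          ((2 * g + of_nat (2 * j) + 1) * (of_nat (2 * j) + 2 * s)) * watson_sum s g (2 * j)"
      using ne by simp
    also have "(2 * s + of_nat (2 * j) - 2 * g) * (of_nat (2 * j) + 1) /
          ((2 * g + of_nat (2 * j) + 1) * (of_nat (2 * j) + 2 * s))
        = (1/2 + of_nat j) * (s - g + of_nat j) / ((s + of_nat j) * (g + 1/2 + of_nat j))"
      using ne pochhammer_nonzero(2)[OF s(2), of j]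
      by (simp add: divide_simps) (simp add: algebra_simps)?
    finally show ?case
      unfolding Suc.IH pochhammer_Suc by (simp add: mult_ac)
  qed
qed

section \<open>Fourier inversion and Parseval\<close>

lemma integrable_pair_mult_bounded:
  fixes f g :: "real \<Rightarrow> complex" and k :: "real \<Rightarrow> real \<Rightarrow> complex"
  assumes f: "integrable lborel f" and g: "integrable lborel g"
    and k: "(\<lambda>(x, y). k x y) \<in> borel_measurable (lborel \<Otimes>\<^sub>M lborel)"
    and bound: "\<And>x y. norm (k x y) \<le> 1"
  shows "integrable (lborel \<Otimes>\<^sub>M lborel) (\<lambda>(x, y). f x * g y * k x y)"
proof (rule Bochner_Integration.integrable_bound)
  have [measurable]: "f \<in> borel_measurable lborel" "g \<in> borel_measurable lborel"
    using f g by auto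
  note k[measurable]
  show "integrable (lborel \<Otimes>\<^sub>M lborel) (\<lambda>(x, y). norm (f x) * norm (g y))"
  proof (rule lborel_pair.Fubini_integrable)
    show "integrable lborel (\<lambda>x. \<integral>y. norm (case (x, y) of (x, y) \<Rightarrow> norm (f x) * norm (g y)) \<partial>lborel)"
      using f g by simp
    show "AE x in lborel. integrable lborel (\<lambda>y. case (x, y) of (x, y) \<Rightarrow> norm (f x) * norm (g y))"
      using g by simp
  qed measurable
  show "(\<lambda>(x, y). f x * g y * k x y) \<in> borel_measurable (lborel \<Otimes>\<^sub>M lborel)"
    using k by (simp add: case_prod_beta)
  show "AE x in lborel \<Otimes>\<^sub>M lborel. norm (case x of (x, y) \<Rightarrow> f x * g y * k x y)
     \<le> norm (case x of (x, y) \<Rightarrow> norm (f x) * norm (g y))"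
    using bound by (auto simp: norm_mult mult_left_le)
qed

lemma fourier_std_normal_density:
  "(\<integral>x. iexp (t * x) * std_normal_density x \<partial>lborel) = exp (- (t\<^sup>2) / 2)"
proof -
  have "(\<integral>x. iexp (t * x) * std_normal_density x \<partial>lborel)
      = (\<integral>x. std_normal_density x *\<^sub>R iexp (t * x) \<partial>lborel)"
    by (simp add: scaleR_conv_of_real mult.commute)
  also have "\<dots> = char std_normal_distribution t"
    by (subst char_def, subst integral_density) (auto simp: normal_density_nonneg)
  finally show ?thesis
    by (simp add: char_std_normal_distribution)
qed

lemma fourier_scaled_normal_density:
  assumes "\<epsilon> > 0"
  shows "(\<integral>x. iexp (t * x) * std_normal_density (\<epsilon> * x) \<partial>lborel)
    = of_real (sqrt (2 * pi) / \<epsilon> * std_normal_density (t / \<epsilon>))"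
proof -
  have "(\<integral>x. iexp (t * x) * std_normal_density (\<epsilon> * x) \<partial>lborel)
      = of_real \<bar>1/\<epsilon>\<bar> * (\<integral>x. iexp (t / \<epsilon> * x) * std_normal_density x \<partial>lborel)"
    using assms by (subst lborel_integral_real_affine[where c = "1/\<epsilon>" and t = 0])
      (auto simp: scaleR_conv_of_real)
  also have "\<dots> = of_real (sqrt (2 * pi) / \<epsilon> * std_normal_density (t / \<epsilon>))"
    using assms by (subst fourier_std_normal_density) (simp add: std_normal_density_def)
  finally show ?thesis .
qed

lemma integrable_scaled_normal_density:
  assumes "\<epsilon> > 0"
  shows "integrable lborel (\<lambda>x. complex_of_real (std_normal_density (\<epsilon> * x)))"
  using lborel_integrable_real_affine[OF integrable_normal_density[of 1 0], of \<epsilon> 0] assms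
  by (intro integrable_of_real) simp

text \<open>The damping factor \<open>std_normal_density (\<epsilon> * x)\<close> makes Fubini applicable; it turns the
  double integral into a convolution of \<open>f\<close> with an approximate identity.\<close>

lemma fourier_inversion:
  fixes f F :: "real \<Rightarrow> complex"
  assumes f: "integrable lborel f" and cont: "continuous_on UNIV f"
    and bound: "\<And>s. norm (f s) \<le> B"
    and F: "\<And>x. F x = (\<integral>s. f s * iexp (s * x) \<partial>lborel)" and int_F: "integrable lborel F"
  shows "(\<integral>x. F x * iexp (- (u * x)) \<partial>lborel) = 2 * pi * f u"
proof -
  define \<epsilon> :: "nat \<Rightarrow> real" where "\<epsilon> = (\<lambda>n. 1 / real (Suc n))"
  have \<epsilon>0: "\<epsilon> n > 0" for n by (simp add: \<epsilon>_def)
  have \<epsilon>_lim: "\<epsilon> \<longlonglongrightarrow> 0" unfolding \<epsilon>_def by (rule LIMSEQ_Suc[OF lim_1_over_n])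
  have [measurable]: "f \<in> borel_measurable lborel" "F \<in> borel_measurable lborel"
    using f int_F by auto
  define A where "A = (\<lambda>n. \<integral>x. F x * iexp (- (u * x)) * std_normal_density (\<epsilon> n * x) \<partial>lborel)"
  have dens_le: "std_normal_density y \<le> 1" for y
  proof -
    have "sqrt (2 * pi) \<ge> 1" using pi_gt3 by simp
    moreover have "exp (- y\<^sup>2 / 2) \<le> 1" by simp
    ultimately have "exp (- y\<^sup>2 / 2) \<le> sqrt (2 * pi)" by linarith
    then show ?thesis using pi_gt_zero by (simp add: std_normal_density_def divide_simps)
  qed
  have A_eq: "A n = sqrt (2 * pi) * (\<integral>v. f (u + \<epsilon> n * v) * std_normal_density v \<partial>lborel)" for n
  proof -
    have "A n = (\<integral>x. (\<integral>s. f s * std_normal_density (\<epsilon> n * x) * iexp ((s - u) * x) \<partial>lborel) \<partial>lborel)"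
      unfolding A_def F integral_mult_left_zero[symmetric]
      by (intro Bochner_Integration.integral_cong refl)
        (auto simp: exp_add[symmetric] algebra_simps)
    also have "\<dots> = (\<integral>s. (\<integral>x. f s * std_normal_density (\<epsilon> n * x) * iexp ((s - u) * x) \<partial>lborel) \<partial>lborel)"
      by (rule lborel_pair.Fubini_integral, rule integrable_pair_mult_bounded)
        (use f integrable_scaled_normal_density[OF \<epsilon>0] in auto)
    also have "\<dots> = (\<integral>s. f s * (\<integral>x. iexp ((s - u) * x) * std_normal_density (\<epsilon> n * x) \<partial>lborel) \<partial>lborel)"
      unfolding integral_mult_right_zero[symmetric]
      by (simp add: mult_ac)
    also have "\<dots> = (\<integral>s. f s * of_real (sqrt (2 * pi) / \<epsilon> n * std_normal_density ((s - u) / \<epsilon> n)) \<partial>lborel)"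
      by (simp only: fourier_scaled_normal_density[OF \<epsilon>0])
    also have "\<dots> = \<bar>\<epsilon> n\<bar> *\<^sub>R (\<integral>v. f (u + \<epsilon> n * v)
         * of_real (sqrt (2 * pi) / \<epsilon> n * std_normal_density ((u + \<epsilon> n * v - u) / \<epsilon> n)) \<partial>lborel)"
      using \<epsilon>0[of n] by (subst lborel_integral_real_affine[where c = "\<epsilon> n" and t = u]) auto
    also have "\<dots> = sqrt (2 * pi) * (\<integral>v. f (u + \<epsilon> n * v) * std_normal_density v \<partial>lborel)"
      using \<epsilon>0[of n] unfolding scaleR_conv_of_real integral_mult_right_zero[symmetric]
      by (intro Bochner_Integration.integral_cong refl) simp
    finally show ?thesis .
  qed
  have "(\<lambda>n. \<integral>v. f (u + \<epsilon> n * v) * std_normal_density v \<partial>lborel)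
      \<longlonglongrightarrow> (\<integral>v. f u * std_normal_density v \<partial>lborel)"
  proof (rule integral_dominated_convergence[where w = "\<lambda>v. B * std_normal_density v"])
    show "AE v in lborel. (\<lambda>n. f (u + \<epsilon> n * v) * std_normal_density v) \<longlonglongrightarrow> f u * std_normal_density v"
    proof (intro AE_I2 tendsto_mult tendsto_const)
      fix v
      have "(\<lambda>n. u + \<epsilon> n * v) \<longlonglongrightarrow> u + 0 * v" by (intro tendsto_intros \<epsilon>_lim)
      then have "(\<lambda>n. u + \<epsilon> n * v) \<longlonglongrightarrow> u" by simp
      then show "(\<lambda>n. f (u + \<epsilon> n * v)) \<longlonglongrightarrow> f u"
        using cont by (auto simp: continuous_on_eq_continuous_at intro: isCont_tendsto_compose)
    qed
    show "AE v in lborel. norm (f (u + \<epsilon> n * v) * std_normal_density v) \<le> B * std_normal_density v" for n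
      by (auto simp: norm_mult normal_density_nonneg intro!: mult_right_mono bound)
    show "integrable lborel (\<lambda>v. B * std_normal_density v)" by simp
  qed measurable
  moreover have "(\<integral>v. f u * std_normal_density v \<partial>lborel) = f u"
    by (subst integral_mult_right_zero) (simp add: integral_normal_density)
  ultimately have "(\<lambda>n. \<integral>v. f (u + \<epsilon> n * v) * std_normal_density v \<partial>lborel) \<longlonglongrightarrow> f u"
    by simp
  then have "(\<lambda>n. sqrt (2 * pi) * (\<integral>v. f (u + \<epsilon> n * v) * std_normal_density v \<partial>lborel))
      \<longlonglongrightarrow> sqrt (2 * pi) * f u"
    by (rule tendsto_mult_left)
  then have lim1: "A \<longlonglongrightarrow> sqrt (2 * pi) * f u"
    by (simp only: A_eq[symmetric])
  \<comment> \<open>The same sequence without Fubini: as the damping is removed, the density tends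
    to its value at 0 while \<open>norm (F x)\<close> dominates.\<close>
  have lim2: "A \<longlonglongrightarrow> (\<integral>x. F x * iexp (- (u * x)) * std_normal_density 0 \<partial>lborel)"
    unfolding A_def
  proof (rule integral_dominated_convergence[where w = "\<lambda>x. norm (F x)"])
    show "AE x in lborel. (\<lambda>n. F x * iexp (- (u * x)) * std_normal_density (\<epsilon> n * x))
        \<longlonglongrightarrow> F x * iexp (- (u * x)) * std_normal_density 0"
    proof (intro AE_I2 tendsto_mult tendsto_const tendsto_of_real)
      fix x
      have "(\<lambda>n. \<epsilon> n * x) \<longlonglongrightarrow> 0 * x" by (intro tendsto_intros \<epsilon>_lim)
      then have *: "(\<lambda>n. \<epsilon> n * x) \<longlonglongrightarrow> 0" by simp
      show "(\<lambda>n. std_normal_density (\<epsilon> n * x)) \<longlonglongrightarrow> std_normal_density 0"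
        unfolding std_normal_density_def
        by (intro tendsto_intros *) auto
    qed
    show "AE x in lborel. norm (F x * iexp (- (u * x)) * std_normal_density (\<epsilon> n * x)) \<le> norm (F x)" for n
      using dens_le by (auto simp: norm_mult normal_density_nonneg intro!: mult_left_le)
    show "integrable lborel (\<lambda>x. norm (F x))" using int_F by simp
  qed measurable
  \<comment> \<open>Since the density at 0 is 1 / sqrt (2 pi), dividing by it supplies the second
    factor sqrt (2 pi) of the constant 2 pi.\<close>
  have "(\<integral>x. F x * iexp (- (u * x)) \<partial>lborel) * std_normal_density 0 = sqrt (2 * pi) * f u"
    using LIMSEQ_unique[OF lim2 lim1] by simp
  moreover have "sqrt (2 * pi) * std_normal_density 0 = 1"
    by (simp add: std_normal_density_def)
  then have "complex_of_real (sqrt (2 * pi)) * std_normal_density 0 = 1"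
    by (metis of_real_1 of_real_mult)
  moreover have "complex_of_real (sqrt (2 * pi)) * of_real (sqrt (2 * pi)) = 2 * pi"
    by (simp flip: of_real_mult)
  moreover have "I = t * f u" if "I * d = s * f u" "s * d = 1" "s * s = t" for I d s t :: complex
  proof -
    have "I = s * (I * d)" using that(2) by (simp add: mult.left_commute)
    then show ?thesis using that(1,3) by (simp add: mult.assoc[symmetric])
  qed
  ultimately show ?thesis by blast
qed

text \<open>The opposite sign in the exponent of \<open>G\<close> takes the place of a complex
  conjugation. After inserting the integral for \<open>G\<close> and exchanging the order, the inner
  integral is the inversion formula for \<open>f\<close>.\<close>

lemma parseval_fourier:
  fixes f F g G :: "real \<Rightarrow> complex"
  assumes f: "integrable lborel f" and cont: "continuous_on UNIV f"
    and bound: "\<And>s. norm (f s) \<le> B"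
    and F: "\<And>x. F x = (\<integral>s. f s * iexp (s * x) \<partial>lborel)" and int_F: "integrable lborel F"
    and g: "integrable lborel g" and G: "\<And>x. G x = (\<integral>s. g s * iexp (- (s * x)) \<partial>lborel)"
  shows "(\<integral>x. F x * G x \<partial>lborel) = 2 * pi * (\<integral>s. f s * g s \<partial>lborel)"
proof -
  have "(\<integral>x. F x * G x \<partial>lborel) = (\<integral>x. (\<integral>s. g s * F x * iexp (- (s * x)) \<partial>lborel) \<partial>lborel)"
    unfolding G integral_mult_right_zero[symmetric] by (simp add: mult_ac)
  also have "\<dots> = (\<integral>s. (\<integral>x. g s * F x * iexp (- (s * x)) \<partial>lborel) \<partial>lborel)"
    by (rule lborel_pair.Fubini_integral, rule integrable_pair_mult_bounded) (use g int_F in auto)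
  also have "\<dots> = (\<integral>s. g s * (\<integral>x. F x * iexp (- (s * x)) \<partial>lborel) \<partial>lborel)"
    unfolding integral_mult_right_zero[symmetric] by (simp add: mult_ac)
  also have "\<dots> = (\<integral>s. 2 * pi * (f s * g s) \<partial>lborel)"
    by (simp only: fourier_inversion[OF f cont bound F int_F] mult_ac)
  finally show ?thesis by simp
qed

section \<open>Barnes' first lemma\<close>

text \<open>Euler's integral and the change of variables are available for the gauge integral and
  completed Lebesgue measure; Borel measurability allows the passage to
  \<open>lborel\<close>.\<close>

lemma has_bochner_integral_lborel_of_HK:
  fixes f :: "real \<Rightarrow> real"
  assumes "f absolutely_integrable_on UNIV" "integral UNIV f = I" and m: "f \<in> borel_measurable borel"
  shows "has_bochner_integral lborel f I"
proof -
  have *: "integrable lborel f"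
    using assms by (simp add: set_integrable_def integrable_completion)
  then show ?thesis
    using assms(2) integral_lborel[OF *] by (simp add: has_bochner_integral_iff)
qed

text \<open>Euler's integral under t = exp u. On the whole line, the imaginary part of z becomes a
  Fourier variable.\<close>

lemma has_bochner_integral_Gamma:
  assumes z: "Re z > 0"
  shows "has_bochner_integral lborel (\<lambda>u::real. exp (z * of_real u - of_real (exp u))) (Gamma z)"
proof -
  define f where "f = (\<lambda>t::real. of_real t powr (z - 1) / complex_of_real (exp t))"
  have f_exp: "exp u * f (exp u) = exp (z * of_real u - of_real (exp u))" for u :: real
  proof -
    have "of_real (exp u) powr (z - 1) = exp ((z - 1) * of_real u)"
      by (simp add: powr_def Ln_of_real)
    then have "exp u * f (exp u) = exp (complex_of_real u) * (exp ((z - 1) * of_real u) / exp (of_real (exp u)))"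
      by (simp only: f_def exp_of_real)
    also have "\<dots> = exp (complex_of_real u + (z - 1) * of_real u - of_real (exp u))"
      by (simp only: exp_add exp_diff times_divide_eq_right)
    finally show ?thesis by (simp add: algebra_simps)
  qed
  have abs_int: "f absolutely_integrable_on {0<..}"
    unfolding f_def using z by (rule absolutely_integrable_Gamma_integral')
  have int: "(f has_integral Gamma z) {0<..}"
    unfolding f_def using z by (rule Gamma_integral_complex')
  have img: "range exp = {0::real<..}"
    by (auto simp: image_iff) (metis exp_ln)
  \<comment> \<open>The change of variables is carried out for real-valued functions;
    \<open>L\<close> stands for \<open>Re\<close> and \<open>Im\<close>, and the two results are
    recombined at the end.\<close>
  have *: "has_bochner_integral lborel (\<lambda>u. L (exp (z * of_real u - of_real (exp u)))) (L (Gamma z))"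
    if L: "bounded_linear L" and cont: "continuous_on UNIV L" for L :: "complex \<Rightarrow> real"
  proof (rule has_bochner_integral_lborel_of_HK)
    have "(\<lambda>t. L (f t)) absolutely_integrable_on range exp \<and> integral (range exp) (\<lambda>t. L (f t)) = L (Gamma z)"
      unfolding img using absolutely_integrable_linear[OF abs_int L] has_integral_linear[OF int L]
      by (auto simp: o_def integral_unique)
    then have "(\<lambda>u. \<bar>exp u\<bar> * L (f (exp u))) absolutely_integrable_on UNIV \<and>
        integral UNIV (\<lambda>u. \<bar>exp u\<bar> * L (f (exp u))) = L (Gamma z)"
      by (subst has_absolute_integral_change_of_variables_1')
        (auto intro!: derivative_eq_intros simp: inj_on_def)
    moreover have "(\<lambda>u. \<bar>exp u\<bar> * L (f (exp u))) = (\<lambda>u. L (exp (z * of_real u - of_real (exp u))))"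
    proof
      fix u
      have "exp (z * of_real u - of_real (exp u)) = exp u *\<^sub>R f (exp u)"
        by (simp only: f_exp scaleR_conv_of_real)
      then show "\<bar>exp u\<bar> * L (f (exp u)) = L (exp (z * of_real u - of_real (exp u)))"
        using linear_cmul[OF bounded_linear.linear[OF L]] by simp
    qed
    ultimately show "(\<lambda>u. L (exp (z * of_real u - of_real (exp u)))) absolutely_integrable_on UNIV"
        "integral UNIV (\<lambda>u. L (exp (z * of_real u - of_real (exp u)))) = L (Gamma z)"
      by simp_all
    show "(\<lambda>u. L (exp (z * of_real u - of_real (exp u)))) \<in> borel_measurable borel"
      by (intro borel_measurable_continuous_onI continuous_on_compose2[OF cont] continuous_intros) auto
  qed
  have "has_bochner_integral lborel
      (\<lambda>u. of_real (Re (exp (z * of_real u - of_real (exp u)))) + \<i> * of_real (Im (exp (z * of_real u - of_real (exp u)))))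
      (of_real (Re (Gamma z)) + \<i> * of_real (Im (Gamma z)))"
    by (intro has_bochner_integral_add has_bochner_integral_mult_right has_bochner_integral_of_real *
        bounded_linear_Re bounded_linear_Im continuous_intros)
  then show ?thesis by (simp flip: complex_eq)
qed

lemma has_bochner_integral_Gamma_real:
  fixes a :: real
  assumes "a > 0"
  shows "has_bochner_integral lborel (\<lambda>u. exp (a * u - exp u)) (Gamma a)"
  using has_bochner_integral_Re[OF has_bochner_integral_Gamma[of "of_real a"]] assms
  by (simp add: Gamma_complex_of_real Re_exp)

lemma norm_Gamma_le:
  assumes "Re z > 0"
  shows "norm (Gamma z) \<le> Gamma (Re z)"
proof -
  have "norm (Gamma z) = norm (\<integral>u. exp (z * of_real u - of_real (exp u)) \<partial>lborel)"
    using has_bochner_integral_Gamma[OF assms] by (simp add: has_bochner_integral_iff)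
  also have "\<dots> \<le> (\<integral>u. norm (exp (z * of_real u - of_real (exp u))) \<partial>lborel)"
    by (rule integral_norm_bound)
  also have "\<dots> = Gamma (Re z)"
    using has_bochner_integral_Gamma_real[OF assms]
    by (simp add: has_bochner_integral_iff)
  finally show ?thesis .
qed

text \<open>Translation by ln q; the value is Gamma(a) q^(-a). It serves with q = 1 + exp s, where
  it produces the beta density.\<close>

lemma Gamma_scaled_integral:
  fixes a q :: real
  assumes "a > 0" "q > 0"
  shows "has_bochner_integral lborel (\<lambda>v. exp (a * v - q * exp v)) (Gamma a * exp (- a * ln q))"
proof -
  have "has_bochner_integral lborel (\<lambda>v. exp (- a * ln q) * exp (a * (ln q + 1 * v) - exp (ln q + 1 * v)))
     (exp (- a * ln q) * (Gamma a /\<^sub>R \<bar>1\<bar>))"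
    by (intro has_bochner_integral_mult_right
        lborel_has_bochner_integral_real_affine_iff[of 1 "\<lambda>u. exp (a * u - exp u)" _ "ln q", THEN iffD1]
        has_bochner_integral_Gamma_real assms) simp
  moreover have "exp (- a * ln q) * exp (a * (ln q + 1 * v) - exp (ln q + 1 * v)) = exp (a * v - q * exp v)" for v
  proof -
    have "exp (ln q + 1 * v) = q * exp v" using assms(2) by (simp add: exp_add)
    moreover have "- a * ln q + (a * (ln q + 1 * v) - q * exp v) = a * v - q * exp v"
      by (simp add: algebra_simps)
    ultimately show ?thesis by (simp only: exp_add[symmetric])
  qed
  ultimately show ?thesis by (simp add: mult.commute)
qed

text \<open>Euler's beta integrand in the variable \<open>s\<close> with \<open>t / (1 - t) = exp s\<close>.\<close>

definition beta_density :: "real \<Rightarrow> real \<Rightarrow> real \<Rightarrow> real" where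
  "beta_density \<alpha> \<gamma> s = Gamma (\<alpha> + \<gamma>) * exp (\<alpha> * s - (\<alpha> + \<gamma>) * ln (1 + exp s))"

lemma beta_density_bound:
  assumes "\<alpha> > 0" "\<gamma> > 0"
  shows "\<bar>beta_density \<alpha> \<gamma> s\<bar> \<le> Gamma (\<alpha> + \<gamma>)"
proof -
  have "0 \<le> ln (1 + exp s)" by simp
  moreover have "s \<le> ln (1 + exp s)" by (subst ln_ge_iff) (auto intro: add_pos_pos)
  ultimately have "\<alpha> * s \<le> \<alpha> * ln (1 + exp s)" "0 \<le> \<gamma> * ln (1 + exp s)"
    using assms by auto
  then have "\<alpha> * s - (\<alpha> + \<gamma>) * ln (1 + exp s) \<le> 0" by (simp add: algebra_simps)
  then have "exp (\<alpha> * s - (\<alpha> + \<gamma>) * ln (1 + exp s)) \<le> 1" by simp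
  then show ?thesis
    using Gamma_real_pos[of "\<alpha> + \<gamma>"] assms by (simp add: beta_density_def abs_mult mult_left_le)
qed

lemma continuous_on_beta_density: "continuous_on UNIV (beta_density \<alpha> \<gamma>)"
proof -
  have "1 + exp s \<noteq> (0::real)" for s using exp_gt_zero[of s] by linarith
  then show ?thesis
    unfolding beta_density_def by (intro continuous_intros) auto
qed

text \<open>Write the product of the two Gamma functions as a double integral over u and v and put u
  = v + s. The phases exp(i x u) and exp(-i x v) combine to exp(i x s), and the remaining integral
  over v is a scaled Gamma integral that no longer involves x.\<close>

lemma fourier_beta_density:
  assumes \<alpha>: "\<alpha> > 0" and \<gamma>: "\<gamma> > 0"
  shows "integrable lborel (\<lambda>s. complex_of_real (beta_density \<alpha> \<gamma> s))"
    and "(\<integral>s. beta_density \<alpha> \<gamma> s * iexp (s * x) \<partial>lborel) = Gamma (\<alpha> + \<i> * x) * Gamma (\<gamma> - \<i> * x)"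
proof -
  define h where "h = (\<lambda>x v s. exp ((\<alpha> + \<i> * of_real x) * of_real (v + s) - of_real (exp (v + s)))
      * exp ((\<gamma> - \<i> * of_real x) * of_real v - of_real (exp v)))" for x v s :: real
  have h_eq: "h x v s = iexp (s * x) * of_real (exp (\<alpha> * s)) * of_real (exp ((\<alpha> + \<gamma>) * v - (1 + exp s) * exp v))" for x v s
  proof -
    have "h x v s = exp (((\<alpha> + \<i> * of_real x) * of_real (v + s) - of_real (exp (v + s)))
        + ((\<gamma> - \<i> * of_real x) * of_real v - of_real (exp v)))"
      by (simp only: h_def exp_add)
    also have "((\<alpha> + \<i> * of_real x) * of_real (v + s) - of_real (exp (v + s)))
        + ((\<gamma> - \<i> * of_real x) * of_real v - of_real (exp v))
      = \<i> * of_real (s * x) + of_real (\<alpha> * s) + of_real ((\<alpha> + \<gamma>) * v - (1 + exp s) * exp v)"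
      by (simp add: algebra_simps exp_add)
    finally show ?thesis
      by (simp only: exp_add exp_of_real)
  qed
  have inner_s: "has_bochner_integral lborel (\<lambda>s. exp (z * of_real (v + s) - of_real (exp (v + s)))) (Gamma z)"
    if "Re z > 0" for v :: real and z
    using lborel_has_bochner_integral_real_affine_iff[of 1
      "\<lambda>u. exp (z * of_real u - of_real (exp u))" "Gamma z" v, THEN iffD1,
      OF _ has_bochner_integral_Gamma[OF that]] by simp
  have inner_v: "has_bochner_integral lborel (\<lambda>v. h x v s) (beta_density \<alpha> \<gamma> s * iexp (s * x))" for x s
  proof -
    have "has_bochner_integral lborel (\<lambda>v. iexp (s * x) * of_real (exp (\<alpha> * s))
          * complex_of_real (exp ((\<alpha> + \<gamma>) * v - (1 + exp s) * exp v)))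
        (iexp (s * x) * of_real (exp (\<alpha> * s)) * complex_of_real (Gamma (\<alpha> + \<gamma>) * exp (- (\<alpha> + \<gamma>) * ln (1 + exp s))))"
      by (intro has_bochner_integral_mult_right has_bochner_integral_of_real Gamma_scaled_integral)
        (use \<alpha> \<gamma> in \<open>auto intro: add_pos_pos\<close>)
    also have "iexp (s * x) * of_real (exp (\<alpha> * s)) * complex_of_real (Gamma (\<alpha> + \<gamma>) * exp (- (\<alpha> + \<gamma>) * ln (1 + exp s)))
        = beta_density \<alpha> \<gamma> s * iexp (s * x)"
      unfolding beta_density_def diff_conv_add_uminus exp_add by (simp del: minus_add_distrib)
    finally show ?thesis
      unfolding h_eq .
  qed
  \<comment> \<open>The modulus of \<open>h x v s\<close> does not depend on x, and its integral
    over s is Gamma(\<alpha>) times a Gamma integrand in v, by translation invariance.\<close>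
  have int_h: "integrable (lborel \<Otimes>\<^sub>M lborel) (\<lambda>(v, s). h x v s)" for x
  proof (rule lborel_pair.Fubini_integrable)
    show "(\<lambda>(v, s). h x v s) \<in> borel_measurable (lborel \<Otimes>\<^sub>M lborel)"
      unfolding h_def by measurable
    have "norm (h x v s) = norm (exp (complex_of_real \<alpha> * of_real (v + s) - of_real (exp (v + s))))
        * exp (\<gamma> * v - exp v)" for v s
      by (simp add: h_def norm_mult)
    moreover have "(\<integral>s. norm (exp (complex_of_real \<alpha> * of_real (v + s) - of_real (exp (v + s)))) \<partial>lborel) = Gamma \<alpha>" for v
      using has_bochner_integral_Re[OF inner_s[of "of_real \<alpha>" v]] \<alpha>
      by (simp add: has_bochner_integral_iff Gamma_complex_of_real Re_exp)
    ultimately have "(\<integral>s. norm (h x v s) \<partial>lborel) = Gamma \<alpha> * exp (\<gamma> * v - exp v)" for v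
      by simp
    then show "integrable lborel (\<lambda>v. \<integral>s. norm (case (v, s) of (v, s) \<Rightarrow> h x v s) \<partial>lborel)"
      using has_bochner_integral_Gamma_real[OF \<gamma>] by (simp add: has_bochner_integral_iff)
    show "AE v in lborel. integrable lborel (\<lambda>s. case (v, s) of (v, s) \<Rightarrow> h x v s)"
      using inner_s[of "\<alpha> + \<i> * of_real x"] \<alpha> by (auto simp: h_def has_bochner_integral_iff)
  qed
  have eq_v: "(\<integral>v. h x v s \<partial>lborel) = beta_density \<alpha> \<gamma> s * iexp (s * x)" for x s
    using inner_v by (simp add: has_bochner_integral_iff)
  show "integrable lborel (\<lambda>s. complex_of_real (beta_density \<alpha> \<gamma> s))"
    using lborel_pair.integrable_snd[OF int_h[of 0]] by (simp add: eq_v)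
  have "(\<integral>s. beta_density \<alpha> \<gamma> s * iexp (s * x) \<partial>lborel) = (\<integral>v. (\<integral>s. h x v s \<partial>lborel) \<partial>lborel)"
    using lborel_pair.Fubini_integral[OF int_h[of x]] by (simp add: eq_v)
  also have "\<dots> = (\<integral>v. Gamma (\<alpha> + \<i> * x) * exp ((\<gamma> - \<i> * of_real x) * of_real v - of_real (exp v)) \<partial>lborel)"
    using inner_s[of "\<alpha> + \<i> * of_real x"] \<alpha>
    by (intro Bochner_Integration.integral_cong refl) (simp add: h_def has_bochner_integral_iff)
  also have "\<dots> = Gamma (\<alpha> + \<i> * x) * Gamma (\<gamma> - \<i> * x)"
    using has_bochner_integral_Gamma[of "\<gamma> - \<i> * x"] \<gamma> by (simp add: has_bochner_integral_iff)
  finally show "(\<integral>s. beta_density \<alpha> \<gamma> s * iexp (s * x) \<partial>lborel)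
      = Gamma (\<alpha> + \<i> * x) * Gamma (\<gamma> - \<i> * x)" .
qed

section \<open>Size of the Gamma function on vertical lines\<close>

lemma borel_measurable_Gamma_vertical [measurable]:
  assumes "\<alpha> > 0"
  shows "(\<lambda>x. Gamma (complex_of_real \<alpha> + \<i> * of_real x)) \<in> borel_measurable borel"
    and "(\<lambda>x. Gamma (complex_of_real \<alpha> - \<i> * of_real x)) \<in> borel_measurable borel"
proof -
  have *: "complex_of_real \<alpha> + \<i> * of_real x \<notin> \<int>\<^sub>\<le>\<^sub>0" "complex_of_real \<alpha> - \<i> * of_real x \<notin> \<int>\<^sub>\<le>\<^sub>0" for x
    using assms by (auto elim!: nonpos_Ints_cases simp: complex_eq_iff)
  show "(\<lambda>x. Gamma (complex_of_real \<alpha> + \<i> * of_real x)) \<in> borel_measurable borel"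
    by (intro borel_measurable_continuous_onI continuous_at_imp_continuous_on ballI isCont_Gamma continuous_intros *)
  show "(\<lambda>x. Gamma (complex_of_real \<alpha> - \<i> * of_real x)) \<in> borel_measurable borel"
    by (intro borel_measurable_continuous_onI continuous_at_imp_continuous_on ballI isCont_Gamma continuous_intros *)
qed

text \<open>Two steps of the functional equation suffice: Gamma(z) = Gamma(z + 2) / (z (z + 1)) with
  a bounded numerator decays like 1 / x^2.\<close>

lemma integrable_Gamma_vertical:
  assumes \<alpha>: "\<alpha> > 0"
  shows "integrable lborel (\<lambda>x. Gamma (complex_of_real \<alpha> + \<i> * of_real x))"
proof (rule Bochner_Integration.integrable_bound)
  \<comment> \<open>The maximum is the price of replacing \<alpha>^2 + x^2 by 1 + x^2.\<close>
  define K where "K = Gamma (\<alpha> + 2) * max 1 (1 / \<alpha>\<^sup>2)"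
  show "integrable lborel (\<lambda>x. K * inverse (1 + x\<^sup>2))"
    using integrable_inverse_1_plus_square by (auto simp: set_integrable_def einterval_def)
  show "(\<lambda>x. Gamma (complex_of_real \<alpha> + \<i> * of_real x)) \<in> borel_measurable lborel"
    using borel_measurable_Gamma_vertical[OF \<alpha>] by simp
  have "norm (Gamma (complex_of_real \<alpha> + \<i> * of_real x)) \<le> K * inverse (1 + x\<^sup>2)" for x
  proof -
    define z where "z = complex_of_real \<alpha> + \<i> * of_real x"
    have z: "Re z > 0" "Re (z + 1) > 0" using \<alpha> by (simp_all add: z_def)
    have z': "z \<notin> \<int>\<^sub>\<le>\<^sub>0" "z + 1 \<notin> \<int>\<^sub>\<le>\<^sub>0" using z by (auto elim!: nonpos_Ints_cases simp: complex_eq_iff)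
    have "Gamma (z + 2) = (z + 1) * z * Gamma z"
      using Gamma_plus1[OF z'(1)] Gamma_plus1[OF z'(2)] by (simp add: algebra_simps)
    then have "norm (z + 1) * norm z * norm (Gamma z) = norm (Gamma (z + 2))"
      by (simp add: norm_mult)
    also have "\<dots> \<le> Gamma (\<alpha> + 2)"
      using norm_Gamma_le[of "z + 2"] \<alpha> by (simp add: z_def)
    finally have 1: "norm (z + 1) * norm z * norm (Gamma z) \<le> Gamma (\<alpha> + 2)" .
    have n: "norm z = sqrt (\<alpha>\<^sup>2 + x\<^sup>2)" "norm (z + 1) = sqrt ((\<alpha> + 1)\<^sup>2 + x\<^sup>2)"
      by (simp_all add: z_def cmod_def)
    have "norm z \<le> norm (z + 1)" unfolding n using \<alpha> by (simp add: power_mono)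
    then have "norm z * norm z \<le> norm (z + 1) * norm z" by (intro mult_right_mono) auto
    then have "\<alpha>\<^sup>2 + x\<^sup>2 \<le> norm (z + 1) * norm z" unfolding n by simp
    then have "(\<alpha>\<^sup>2 + x\<^sup>2) * norm (Gamma z) \<le> norm (z + 1) * norm z * norm (Gamma z)"
      by (intro mult_right_mono) auto
    with 1 have 2: "(\<alpha>\<^sup>2 + x\<^sup>2) * norm (Gamma z) \<le> Gamma (\<alpha> + 2)" by linarith
    have "1 + x\<^sup>2 \<le> max 1 (1 / \<alpha>\<^sup>2) * (\<alpha>\<^sup>2 + x\<^sup>2)"
    proof -
      have "1 / \<alpha>\<^sup>2 * \<alpha>\<^sup>2 \<le> max 1 (1 / \<alpha>\<^sup>2) * \<alpha>\<^sup>2" by (intro mult_right_mono) auto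
      moreover have "1 * x\<^sup>2 \<le> max 1 (1 / \<alpha>\<^sup>2) * x\<^sup>2" by (intro mult_right_mono) auto
      ultimately show ?thesis using \<alpha> by (simp add: algebra_simps)
    qed
    then have "(1 + x\<^sup>2) * norm (Gamma z) \<le> max 1 (1 / \<alpha>\<^sup>2) * (\<alpha>\<^sup>2 + x\<^sup>2) * norm (Gamma z)"
      by (intro mult_right_mono) auto
    also have "\<dots> \<le> max 1 (1 / \<alpha>\<^sup>2) * Gamma (\<alpha> + 2)"
      using mult_left_mono[OF 2, of "max 1 (1 / \<alpha>\<^sup>2)"] by (simp add: mult_ac)
    finally have "(1 + x\<^sup>2) * norm (Gamma z) \<le> K" by (simp add: K_def mult_ac)
    moreover have "1 + x\<^sup>2 > 0" by (simp add: add_pos_nonneg)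
    ultimately show ?thesis unfolding z_def by (simp add: field_simps)
  qed
  moreover have "K \<ge> 0"
    using Gamma_real_pos[of "\<alpha> + 2"] \<alpha> by (simp add: K_def)
  ultimately show "AE x in lborel. norm (Gamma (complex_of_real \<alpha> + \<i> * of_real x)) \<le> norm (K * inverse (1 + x\<^sup>2))"
    by (auto simp: abs_mult)
qed

lemma norm_Gamma_vertical_le:
  assumes "\<alpha> > 0"
  shows "norm (Gamma (complex_of_real \<alpha> + \<i> * of_real x)) \<le> Gamma \<alpha>"
    and "norm (Gamma (complex_of_real \<alpha> - \<i> * of_real x)) \<le> Gamma \<alpha>"
  using norm_Gamma_le[of "complex_of_real \<alpha> + \<i> * of_real x"]
    norm_Gamma_le[of "complex_of_real \<alpha> - \<i> * of_real x"] assms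
  by simp_all

lemma integrable_Gamma_Gamma:
  assumes "\<alpha> > 0" "\<gamma> > 0"
  shows "integrable lborel (\<lambda>x. Gamma (complex_of_real \<alpha> + \<i> * of_real x) * Gamma (complex_of_real \<gamma> - \<i> * of_real x))"
proof (rule Bochner_Integration.integrable_bound)
  show "integrable lborel (\<lambda>x. Gamma \<gamma> * Gamma (complex_of_real \<alpha> + \<i> * of_real x))"
    using integrable_Gamma_vertical[OF assms(1)] by simp
  show "(\<lambda>x. Gamma (complex_of_real \<alpha> + \<i> * of_real x) * Gamma (complex_of_real \<gamma> - \<i> * of_real x))
      \<in> borel_measurable lborel"
    using assms by measurable
  show "AE x in lborel. norm (Gamma (complex_of_real \<alpha> + \<i> * of_real x) * Gamma (complex_of_real \<gamma> - \<i> * of_real x))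
      \<le> norm (Gamma \<gamma> * Gamma (complex_of_real \<alpha> + \<i> * of_real x))"
    using assms Gamma_real_pos[of \<gamma>]
    by (auto simp: norm_mult mult.commute intro!: mult_right_mono norm_Gamma_vertical_le)
qed

text \<open>The factors are grouped as (\<alpha>, \<gamma>) and (\<delta>, \<beta>), each pair being
  a Fourier transform of a beta density, with opposite signs of x. The product of the two densities
  is proportional to a third one, whose total mass is its own transform at frequency 0.\<close>

lemma barnes_first_lemma:
  assumes "\<alpha> > 0" "\<beta> > 0" "\<gamma> > 0" "\<delta> > 0"
  shows "has_bochner_integral lborel
    (\<lambda>x. Gamma (complex_of_real \<alpha> + \<i> * of_real x) * Gamma (complex_of_real \<beta> + \<i> * of_real x)
       * Gamma (complex_of_real \<gamma> - \<i> * of_real x) * Gamma (complex_of_real \<delta> - \<i> * of_real x))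
    (of_real (2 * pi * (Gamma (\<alpha> + \<gamma>) * Gamma (\<alpha> + \<delta>) * Gamma (\<beta> + \<gamma>) * Gamma (\<beta> + \<delta>)
        / Gamma (\<alpha> + \<beta> + \<gamma> + \<delta>))))"
proof -
  define F where "F = (\<lambda>x. Gamma (complex_of_real \<alpha> + \<i> * of_real x) * Gamma (complex_of_real \<gamma> - \<i> * of_real x))"
  define G where "G = (\<lambda>x. Gamma (complex_of_real \<delta> - \<i> * of_real x) * Gamma (complex_of_real \<beta> + \<i> * of_real x))"
  have int_F: "integrable lborel F"
    unfolding F_def by (rule integrable_Gamma_Gamma) fact+
  have G_bound: "norm (G x) \<le> Gamma \<delta> * Gamma \<beta>" for x
    unfolding G_def norm_mult
    by (intro mult_mono norm_Gamma_vertical_le assms norm_ge_zero less_imp_le Gamma_real_pos)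
  have "integrable lborel (\<lambda>x. F x * G x)"
  proof (rule Bochner_Integration.integrable_bound)
    show "integrable lborel (\<lambda>x. Gamma \<delta> * Gamma \<beta> * norm (F x))" using int_F by simp
    show "(\<lambda>x. F x * G x) \<in> borel_measurable lborel"
      using assms unfolding F_def G_def by measurable
    show "AE x in lborel. norm (F x * G x) \<le> norm (Gamma \<delta> * Gamma \<beta> * norm (F x))"
      using G_bound Gamma_real_pos[OF \<open>\<delta> > 0\<close>] Gamma_real_pos[OF \<open>\<beta> > 0\<close>]
      by (auto simp: norm_mult abs_mult mult.commute intro!: mult_left_mono)
  qed
  moreover have "(\<integral>x. F x * G x \<partial>lborel)
      = 2 * pi * (\<integral>s. complex_of_real (beta_density \<alpha> \<gamma> s) * of_real (beta_density \<delta> \<beta> s) \<partial>lborel)"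
  proof (rule parseval_fourier[OF _ _ _ _ int_F])
    show "norm (complex_of_real (beta_density \<alpha> \<gamma> s)) \<le> Gamma (\<alpha> + \<gamma>)" for s
      using beta_density_bound[OF assms(1,3)] by simp
    show "continuous_on UNIV (\<lambda>s. complex_of_real (beta_density \<alpha> \<gamma> s))"
      by (intro continuous_intros continuous_on_beta_density)
    show "F x = (\<integral>s. complex_of_real (beta_density \<alpha> \<gamma> s) * iexp (s * x) \<partial>lborel)" for x
      using fourier_beta_density(2)[OF assms(1,3), of x] by (simp add: F_def)
    show "G x = (\<integral>s. complex_of_real (beta_density \<delta> \<beta> s) * iexp (- (s * x)) \<partial>lborel)" for x
      using fourier_beta_density(2)[OF assms(4,2), of "- x"] by (simp add: G_def)
  qed (use fourier_beta_density(1) assms in auto)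
  moreover have "complex_of_real (beta_density \<alpha> \<gamma> s) * of_real (beta_density \<delta> \<beta> s)
      = of_real (Gamma (\<alpha> + \<gamma>) * Gamma (\<beta> + \<delta>) / Gamma (\<alpha> + \<beta> + \<gamma> + \<delta>)) * beta_density (\<alpha> + \<delta>) (\<beta> + \<gamma>) s" for s
    using Gamma_real_pos[of "\<alpha> + (\<beta> + (\<delta> + \<gamma>))", THEN less_imp_neq, THEN not_sym] assms
    by (simp add: beta_density_def exp_diff field_simps exp_add add_ac flip: of_real_mult)
  moreover have "(\<integral>s. complex_of_real (beta_density (\<alpha> + \<delta>) (\<beta> + \<gamma>) s) \<partial>lborel)
      = of_real (Gamma (\<alpha> + \<delta>) * Gamma (\<beta> + \<gamma>))"
    using fourier_beta_density(2)[of "\<alpha> + \<delta>" "\<beta> + \<gamma>" 0] assms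
    by (simp add: Gamma_complex_of_real flip: of_real_add)
  ultimately show ?thesis
    unfolding has_bochner_integral_iff F_def G_def by (simp add: mult_ac)
qed

section \<open>Continuous Hahn polynomials\<close>

text \<open>Reversing the summation exchanges (y, u) with (s - y, v). Together with
  \<open>convolution_sum_transform\<close> this gives the symmetry of the Hahn polynomial between
  its two forms.\<close>

lemma convolution_sum_swap:
  fixes s u v y :: "'a::field_char_0"
  shows "(\<Sum>m\<le>N. (-1) ^ m * pochhammer y m * pochhammer (s - y) (N - m)
            / (fact m * pochhammer u m * fact (N - m) * pochhammer v (N - m)))
    = (-1) ^ N * (\<Sum>m\<le>N. (-1) ^ m * pochhammer (s - y) m * pochhammer y (N - m)
            / (fact m * pochhammer v m * fact (N - m) * pochhammer u (N - m)))"
proof -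
  have "(\<Sum>m\<le>N. (-1) ^ m * pochhammer y m * pochhammer (s - y) (N - m)
            / (fact m * pochhammer u m * fact (N - m) * pochhammer v (N - m)))
    = (\<Sum>m\<le>N. (-1) ^ (N - m) * pochhammer y (N - m) * pochhammer (s - y) m
            / (fact (N - m) * pochhammer u (N - m) * fact m * pochhammer v m))"
    by (rule sum.reindex_bij_witness[of _ "\<lambda>m. N - m" "\<lambda>m. N - m"]) auto
  also have "\<dots> = (-1) ^ N * (\<Sum>m\<le>N. (-1) ^ m * pochhammer (s - y) m * pochhammer y (N - m)
            / (fact m * pochhammer v m * fact (N - m) * pochhammer u (N - m)))"
    unfolding sum_distrib_left
  proof (rule sum.cong[OF refl])
    fix m assume "m \<in> {..N}"
    then have "(-1) ^ (N - m) = ((-1) ^ N * (-1) ^ m :: 'a)"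
      by (simp add: uminus_power_if)
    then show "(-1) ^ (N - m) * pochhammer y (N - m) * pochhammer (s - y) m
            / (fact (N - m) * pochhammer u (N - m) * fact m * pochhammer v m)
        = (-1) ^ N * ((-1) ^ m * pochhammer (s - y) m * pochhammer y (N - m)
            / (fact m * pochhammer v m * fact (N - m) * pochhammer u (N - m)))"
      by (simp add: mult_ac)
  qed
  finally show ?thesis .
qed

text \<open>Since (-j)_k vanishes for j < k, the sum starts at j = k. Writing j = k + l splits
  (2\<tau>)_(2k+l) into (2\<tau>)_(2k) and (2(\<tau> + k))_l, so the denominator parameter remains
  twice the numerator parameter \<tau> + k, as Watson's sum requires. For k > N both sides are
  0.\<close>

lemma hahn_connection_sum:
  fixes s \<tau> :: "'a::field_char_0" and k N :: nat
  shows "(\<Sum>j\<le>N. of_nat (N choose j) * (-1) ^ j * pochhammer (of_nat N + 2 * s - 1) j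
      * pochhammer \<tau> j * pochhammer (- of_nat j) k / (pochhammer s j * pochhammer (2 * \<tau>) (j + k)))
    = fact k * of_nat (N choose k) * pochhammer (of_nat N + 2 * s - 1) k * pochhammer \<tau> k
        / (pochhammer s k * pochhammer (2 * \<tau>) (2 * k))
      * watson_sum (s + of_nat k) (\<tau> + of_nat k) (N - k)"
proof (cases "k \<le> N")
  case False
  then show ?thesis
    by (subst sum.neutral) (auto simp: pochhammer_minus_of_nat binomial_eq_0)
next
  case k: True
  let ?f = "\<lambda>j. of_nat (N choose j) * (-1) ^ j * pochhammer (of_nat N + 2 * s - 1) j
      * pochhammer \<tau> j * pochhammer (- of_nat j) k / (pochhammer s j * pochhammer (2 * \<tau>) (j + k))"
  have "(\<Sum>j\<le>N. ?f j) = (\<Sum>j\<in>{k..N}. ?f j)"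
    by (rule sum.mono_neutral_right) (auto simp: pochhammer_minus_of_nat)
  also have "\<dots> = (\<Sum>l\<le>N - k. ?f (k + l))"
    by (rule sum.reindex_bij_witness[of _ "\<lambda>l. k + l" "\<lambda>j. j - k"]) (use k in auto)
  also have "\<dots> = fact k * of_nat (N choose k) * pochhammer (of_nat N + 2 * s - 1) k * pochhammer \<tau> k
        / (pochhammer s k * pochhammer (2 * \<tau>) (2 * k))
      * watson_sum (s + of_nat k) (\<tau> + of_nat k) (N - k)"
    unfolding watson_sum_def sum_distrib_left
  proof (rule sum.cong[OF refl])
    fix l assume "l \<in> {..N - k}"
    then have l: "l \<le> N - k" by simp
    have ch: "(of_nat (N choose (k + l)) * of_nat ((k + l) choose k) :: 'a)
        = of_nat (N choose k) * of_nat ((N - k) choose l)"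
      using choose_mult[of k "k + l" N] k l by (simp flip: of_nat_mult)
    have 2: "pochhammer (2 * \<tau>) (k + l + k) = pochhammer (2 * \<tau>) (2 * k) * pochhammer (2 * (\<tau> + of_nat k)) l"
    proof -
      have "k + l + k = 2 * k + l" by simp
      then show ?thesis
        by (simp only: pochhammer_product' of_nat_mult of_nat_numeral distrib_left)
    qed
    have 3: "of_nat N + 2 * s - 1 + of_nat k = of_nat (N - k) + 2 * (s + of_nat k) - 1"
      using k by (simp add: of_nat_diff algebra_simps)
    have "?f (k + l) = (of_nat (N choose (k + l)) * of_nat ((k + l) choose k)) * fact k * (-1) ^ l
        * pochhammer (of_nat N + 2 * s - 1) (k + l) * pochhammer \<tau> (k + l)
        / (pochhammer s (k + l) * pochhammer (2 * \<tau>) (k + l + k))"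
      by (simp add: pochhammer_minus_of_nat power_add del: of_nat_add)
    also have "\<dots> = fact k * of_nat (N choose k) * pochhammer (of_nat N + 2 * s - 1) k * pochhammer \<tau> k
        / (pochhammer s k * pochhammer (2 * \<tau>) (2 * k))
        * (of_nat ((N - k) choose l) * (-1) ^ l * pochhammer (of_nat (N - k) + 2 * (s + of_nat k) - 1) l
           * pochhammer (\<tau> + of_nat k) l
           / (pochhammer (s + of_nat k) l * pochhammer (2 * (\<tau> + of_nat k)) l))"
      unfolding ch 2 pochhammer_product'[of _ k l] 3 by (simp add: mult_ac)
    finally show "?f (k + l) = \<dots>" .
  qed
  finally show ?thesis .
qed

lemma suminf_terminating:
  fixes f :: "nat \<Rightarrow> 'a::{t2_space, comm_monoid_add}"
  assumes "\<And>n. n > k \<Longrightarrow> f n = 0"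
  shows "suminf f = (\<Sum>n\<le>k. f n)"
  by (rule suminf_finite) (use assms in auto)

lemma notin_nonpos_Ints_of_real:
  assumes "r > 0"
  shows "complex_of_real r \<notin> \<int>\<^sub>\<le>\<^sub>0"
  using assms by (auto elim!: nonpos_Ints_cases simp: complex_eq_iff)

text \<open>Equal imaginary parts make a + cnj c real, so the sum depends on x and the imaginary
  parts only through a + i x. This generality, beyond real parameters, serves the final
  translation.\<close>

lemma cont_hahn_eq_sum:
  fixes a c :: complex and A C :: real
  assumes "Re a = A" "Re c = C" "Im a = Im c"
  shows "cont_hahn k x a c = \<i> ^ k * (pochhammer (2 * of_real A) k * pochhammer (of_real A + of_real C) k / fact k) *
      (\<Sum>l\<le>k. of_nat (k choose l) * (-1) ^ l * pochhammer (of_nat k + 2 * of_real A + 2 * of_real C - 1) l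
          * pochhammer (a + \<i> * x) l / (pochhammer (2 * of_real A) l * pochhammer (of_real A + of_real C) l))"
proof -
  have ac: "a + cnj c = of_real A + of_real C"
    using assms by (simp add: complex_eq_iff)
  show ?thesis
    unfolding cont_hahn_def hypergeo_def ac assms
    by (subst suminf_terminating[of k]) (auto simp: pochhammer_minus_of_nat mult_ac intro!: sum.cong)
qed

text \<open>Under the weight, \<open>(C - i x)\<^sub>l\<close> shifts a Gamma factor other than the one shifted by
  \<open>(A + i x)\<^sub>j\<close>, which is what makes the products integrable by Barnes' lemma.\<close>

lemma cont_hahn_eq_sum_swap:
  fixes A C :: real and x :: complex and k :: nat
  assumes A: "A > 0" and C: "C > 0"
  shows "cont_hahn k x (of_real A) (of_real C)
    = (- \<i>) ^ k * (pochhammer (2 * of_real C) k * pochhammer (of_real A + of_real C) k / fact k) *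
      (\<Sum>l\<le>k. of_nat (k choose l) * (-1) ^ l * pochhammer (of_nat k + (2 * of_real A + 2 * of_real C) - 1) l
          * pochhammer (of_real C - \<i> * x) l / (pochhammer (2 * of_real C) l * pochhammer (of_real A + of_real C) l))"
proof -
  define a c where "a = complex_of_real A" and "c = complex_of_real C"
  define y where "y = a + \<i> * x"
  have y: "(a + c) - y = c - \<i> * x" by (simp add: y_def)
  have np: "2 * a \<notin> \<int>\<^sub>\<le>\<^sub>0" "2 * c \<notin> \<int>\<^sub>\<le>\<^sub>0" "a + c \<notin> \<int>\<^sub>\<le>\<^sub>0"
    using notin_nonpos_Ints_of_real[of "2 * A"] notin_nonpos_Ints_of_real[of "2 * C"]
      notin_nonpos_Ints_of_real[of "A + C"] assms by (simp_all add: a_def c_def)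
  note nz = pochhammer_nonzero(1)[OF np(1)] pochhammer_nonzero(1)[OF np(2)] pochhammer_nonzero(1)[OF np(3)]
  let ?S = "\<lambda>u v y :: complex. (\<Sum>j\<le>k. of_nat (k choose j) * (-1) ^ j * pochhammer (of_nat k + u + v - 1) j * pochhammer y j
          / (pochhammer u j * pochhammer (a + c) j))"
  \<comment> \<open>The transformation is applied at both ends of the swap: to y with (2a, 2c), and
    to a + c - y with (2c, 2a).\<close>
  have "pochhammer (a + c) k / (fact k * pochhammer (2 * c) k) * ?S (2 * a) (2 * c) y
     = (-1) ^ k * (pochhammer (a + c) k / (fact k * pochhammer (2 * a) k) * ?S (2 * c) (2 * a) (a + c - y))"
    using convolution_sum_transform[OF np(1,2,3), where N = k and y = y] convolution_sum_swap[where y = y and s = "a + c" and N = k and u = "2 * a" and v = "2 * c"]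
      convolution_sum_transform[OF np(2,1,3), where N = k and y = "a + c - y"] by simp
  then have *: "pochhammer (2 * a) k * pochhammer (a + c) k / fact k * ?S (2 * a) (2 * c) y
     = (-1) ^ k * (pochhammer (2 * c) k * pochhammer (a + c) k / fact k * ?S (2 * c) (2 * a) (a + c - y))"
    using nz by (simp add: field_simps)
  have "cont_hahn k x (of_real A) (of_real C)
      = \<i> ^ k * (pochhammer (2 * a) k * pochhammer (a + c) k / fact k * ?S (2 * a) (2 * c) y)"
    by (subst cont_hahn_eq_sum[of _ A _ C]) (simp_all add: a_def c_def y_def)
  also have "\<dots> = (- \<i>) ^ k * (pochhammer (2 * c) k * pochhammer (a + c) k / fact k * ?S (2 * c) (2 * a) (c - \<i> * x))"
    unfolding * y by (subst (3) power_minus) simp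
  finally show ?thesis
    by (simp add: a_def c_def add_ac)
qed

section \<open>Moments of the weight\<close>

definition hahn_weight :: "real \<Rightarrow> real \<Rightarrow> real \<Rightarrow> complex" where
  "hahn_weight A C x = Gamma (of_real A + \<i> * of_real x) * Gamma (of_real C + \<i> * of_real x)
     * Gamma (of_real A - \<i> * of_real x) * Gamma (of_real C - \<i> * of_real x)"

lemma Gamma_mult_pochhammer:
  fixes z :: complex
  assumes "Re z > 0"
  shows "Gamma z * pochhammer z n = Gamma (z + of_nat n)"
proof -
  have "z \<notin> \<int>\<^sub>\<le>\<^sub>0" using assms by (auto elim!: nonpos_Ints_cases)
  then show ?thesis by (simp add: pochhammer_Gamma Gamma_eq_zero_iff)
qed

lemma hahn_weight_moment:
  fixes A C :: real and a c :: complex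
  assumes A: "A > 0" and C: "C > 0"
  defines "a \<equiv> complex_of_real A" and "c \<equiv> complex_of_real C"
  shows "has_bochner_integral lborel
    (\<lambda>x. hahn_weight A C x * pochhammer (a + \<i> * of_real x) j * pochhammer (c - \<i> * of_real x) l)
    (2 * pi * (Gamma (2 * a + of_nat j) * Gamma (a + c + of_nat j + of_nat l) * Gamma (a + c)
       * Gamma (2 * c + of_nat l) / Gamma (2 * a + 2 * c + of_nat j + of_nat l)))"
proof -
  have "hahn_weight A C x * pochhammer (a + \<i> * of_real x) j * pochhammer (c - \<i> * of_real x) l
      = Gamma (of_real (A + real j) + \<i> * of_real x) * Gamma (of_real C + \<i> * of_real x)
        * Gamma (of_real A - \<i> * of_real x) * Gamma (of_real (C + real l) - \<i> * of_real x)" for x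
  proof -
    have "Gamma (a + \<i> * of_real x) * pochhammer (a + \<i> * of_real x) j = Gamma (of_real (A + real j) + \<i> * of_real x)"
      using Gamma_mult_pochhammer[of "a + \<i> * of_real x" j] A by (simp add: a_def add_ac)
    moreover have "Gamma (c - \<i> * of_real x) * pochhammer (c - \<i> * of_real x) l = Gamma (of_real (C + real l) - \<i> * of_real x)"
      using Gamma_mult_pochhammer[of "c - \<i> * of_real x" l] C by (simp add: c_def algebra_simps)
    moreover have "hahn_weight A C x * pochhammer (a + \<i> * of_real x) j * pochhammer (c - \<i> * of_real x) l
      = (Gamma (a + \<i> * of_real x) * pochhammer (a + \<i> * of_real x) j) * Gamma (of_real C + \<i> * of_real x)
        * Gamma (of_real A - \<i> * of_real x) * (Gamma (c - \<i> * of_real x) * pochhammer (c - \<i> * of_real x) l)"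
      by (simp add: hahn_weight_def a_def c_def mult_ac)
    ultimately show ?thesis
      by (simp only:)
  qed
  then show ?thesis
    using barnes_first_lemma[of "A + real j" C A "C + real l"] A C
    by (simp add: a_def c_def Gamma_complex_of_real[symmetric] algebra_simps)
qed

text \<open>In the moments, j and l occur together only in Gamma(a + c + j + l) and in the
  denominator, so the sum over l is a 3F2. It is balanced with \<tau> = a + c and \<sigma> =
  2\<tau>; hence (\<sigma> - \<tau>)_k cancels against (\<tau>)_k and only (-j)_k is left in the
  numerator.\<close>

lemma hahn_weight_pochhammer_cont_hahn:
  fixes A C :: real and a c :: complex
  assumes A: "A > 0" and C: "C > 0"
  defines "a \<equiv> complex_of_real A" and "c \<equiv> complex_of_real C"
  shows "has_bochner_integral lborel
    (\<lambda>x. hahn_weight A C x * pochhammer (a + \<i> * of_real x) j * cont_hahn k (of_real x) a c)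
    ((- \<i>) ^ k * (pochhammer (2 * c) k * pochhammer (a + c) k / fact k)
      * (2 * pi * (Gamma (2 * a) * Gamma (a + c) ^ 2 * Gamma (2 * c) / Gamma (2 * (a + c))))
      * (pochhammer (2 * a) j * pochhammer (a + c) j * pochhammer (- of_nat j) k / pochhammer (2 * (a + c)) (j + k)))"
proof -
  have np: "2 * a \<notin> \<int>\<^sub>\<le>\<^sub>0" "2 * c \<notin> \<int>\<^sub>\<le>\<^sub>0" "a + c \<notin> \<int>\<^sub>\<le>\<^sub>0" "2 * a + 2 * c \<notin> \<int>\<^sub>\<le>\<^sub>0"
    using notin_nonpos_Ints_of_real[of "2 * A"] notin_nonpos_Ints_of_real[of "2 * C"]
      notin_nonpos_Ints_of_real[of "A + C"] notin_nonpos_Ints_of_real[of "2 * A + 2 * C"] A C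
    by (simp_all add: a_def c_def)
  note nz = pochhammer_nonzero(1)[OF np(1)] pochhammer_nonzero(1)[OF np(2)] pochhammer_nonzero(1)[OF np(3)]
    pochhammer_nonzero(1)[OF np(4)]
  define pre where "pre = (- \<i>) ^ k * (pochhammer (2 * c) k * pochhammer (a + c) k / fact k)"
  define co where "co = (\<lambda>l. of_nat (k choose l) * (-1) ^ l * pochhammer (of_nat k + (2 * a + 2 * c) - 1) l
          / (pochhammer (2 * c) l * pochhammer (a + c) l))"
  define G where "G = 2 * pi * (Gamma (2 * a) * Gamma (a + c) ^ 2 * Gamma (2 * c) / Gamma (2 * (a + c)))"
  have "has_bochner_integral lborel
     (\<lambda>x. \<Sum>l\<le>k. pre * co l * (hahn_weight A C x * pochhammer (a + \<i> * of_real x) j * pochhammer (c - \<i> * of_real x) l))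
     (\<Sum>l\<le>k. pre * co l * (2 * pi * (Gamma (2 * a + of_nat j) * Gamma (a + c + of_nat j + of_nat l) * Gamma (a + c)
       * Gamma (2 * c + of_nat l) / Gamma (2 * a + 2 * c + of_nat j + of_nat l))))"
    unfolding a_def c_def
    by (intro has_bochner_integral_sum has_bochner_integral_mult_right hahn_weight_moment A C)
  also have "(\<lambda>x. \<Sum>l\<le>k. pre * co l * (hahn_weight A C x * pochhammer (a + \<i> * of_real x) j * pochhammer (c - \<i> * of_real x) l))
     = (\<lambda>x. hahn_weight A C x * pochhammer (a + \<i> * of_real x) j * cont_hahn k (of_real x) a c)"
    unfolding a_def c_def cont_hahn_eq_sum_swap[OF A C] unfolding pre_def co_def a_def c_def
    by (simp add: sum_distrib_left mult_ac)
  also have "(\<Sum>l\<le>k. pre * co l * (2 * pi * (Gamma (2 * a + of_nat j) * Gamma (a + c + of_nat j + of_nat l) * Gamma (a + c)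
       * Gamma (2 * c + of_nat l) / Gamma (2 * a + 2 * c + of_nat j + of_nat l))))
     = pre * G * (pochhammer (2 * a) j * pochhammer (a + c) j / pochhammer (2 * a + 2 * c) j)
      * (\<Sum>l\<le>k. of_nat (k choose l) * (-1) ^ l * pochhammer (of_nat k + (2 * a + 2 * c) - 1) l
            * pochhammer ((a + c) + of_nat j) l / (pochhammer (a + c) l * pochhammer ((2 * a + 2 * c) + of_nat j) l))"
    unfolding sum_distrib_left
  proof (rule sum.cong[OF refl])
    fix l
    have re: "Re (2 * a) > 0" "Re (2 * c) > 0" "Re (a + c) > 0" "Re (2 * a + 2 * c) > 0"
        "Re (a + c + of_nat j) > 0" "Re (2 * a + 2 * c + of_nat j) > 0"
      using A C by (simp_all add: a_def c_def add_pos_nonneg)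
    note g = re[THEN Gamma_mult_pochhammer, symmetric]
    show "pre * co l * (2 * pi * (Gamma (2 * a + of_nat j) * Gamma (a + c + of_nat j + of_nat l) * Gamma (a + c)
       * Gamma (2 * c + of_nat l) / Gamma (2 * a + 2 * c + of_nat j + of_nat l)))
      = pre * G * (pochhammer (2 * a) j * pochhammer (a + c) j / pochhammer (2 * a + 2 * c) j)
        * (of_nat (k choose l) * (-1) ^ l * pochhammer (of_nat k + (2 * a + 2 * c) - 1) l
            * pochhammer ((a + c) + of_nat j) l / (pochhammer (a + c) l * pochhammer ((2 * a + 2 * c) + of_nat j) l))"
      unfolding g(5)[of l] g(6)[of l] g(1)[of j] g(2)[of l] g(3)[of j] g(4)[of j]
      using nz by (simp add: co_def G_def power2_eq_square divide_simps)
  qed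
  also have "\<dots> = pre * G * (pochhammer (2 * a) j * pochhammer (a + c) j / pochhammer (2 * a + 2 * c) j)
      * (pochhammer (- of_nat j) k / pochhammer (2 * a + 2 * c + of_nat j) k)"
    using saalschuetz[OF np(3,4), of k j] nz by simp
  also have "\<dots> = pre * G * (pochhammer (2 * a) j * pochhammer (a + c) j * pochhammer (- of_nat j) k / pochhammer (2 * (a + c)) (j + k))"
    by (simp add: pochhammer_product' distrib_left)
  finally show ?thesis
    unfolding pre_def G_def .
qed

section \<open>Generating function and dominated exchange\<close>

text \<open>Factor by factor |p + n| <= K (q + n) with K independent of n. A quotient of Pochhammer
  symbols thus grows at most geometrically, and confluent series are dominated by exponential
  ones.\<close>

lemma norm_pochhammer_le:
  fixes p :: complex and q :: real
  assumes "q > 0"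
  shows "norm (pochhammer p n) \<le> max 1 (norm p / q) ^ n * pochhammer q n"
proof (induction n)
  case (Suc n)
  let ?K = "max 1 (norm p / q)"
  have "norm (p + of_nat n) \<le> norm p + real n"
    using norm_triangle_ineq[of p "of_nat n"] by simp
  also have "norm p \<le> ?K * q"
    using assms by (simp add: max_def field_simps)
  also have "real n \<le> ?K * real n"
    using mult_right_mono[of 1 ?K "real n"] by simp
  finally have "norm (p + of_nat n) \<le> ?K * (q + real n)"
    by (simp add: algebra_simps)
  then have "norm (pochhammer p n) * norm (p + of_nat n)
      \<le> (?K ^ n * pochhammer q n) * (?K * (q + real n))"
    using assms by (intro mult_mono Suc.IH mult_nonneg_nonneg pochhammer_nonneg) auto
  then show ?case
    by (simp add: pochhammer_Suc norm_mult mult_ac)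
qed auto

text \<open>The second confluent series brings (B - i x)_n, but the weight offers only Gamma(C - i
  x). Replacing B by C costs a geometric factor that is independent of x, and the result can be
  absorbed into that Gamma factor.\<close>

lemma norm_pochhammer_vertical_le:
  fixes B C x :: real
  assumes "B > 0" "C > 0"
  shows "norm (pochhammer (of_real B - \<i> * of_real x) n)
    \<le> max 1 (B / C) ^ n * norm (pochhammer (of_real C - \<i> * of_real x) n)"
proof (induction n)
  case (Suc n)
  let ?K = "max 1 (B / C)"
  have K: "?K \<ge> 1" by simp
  have "B \<le> ?K * C" using assms by (simp add: max_def field_simps)
  moreover have "real n \<le> ?K * real n" using mult_right_mono[OF K, of "real n"] by simp
  ultimately have "B + real n \<le> ?K * (C + real n)" by (simp add: algebra_simps)
  moreover have "\<bar>x\<bar> \<le> ?K * \<bar>x\<bar>" using mult_right_mono[OF K, of "\<bar>x\<bar>"] by simp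
  ultimately have "(B + real n)\<^sup>2 + \<bar>x\<bar>\<^sup>2 \<le> (?K * (C + real n))\<^sup>2 + (?K * \<bar>x\<bar>)\<^sup>2"
    using assms by (intro add_mono power_mono) auto
  also have "\<dots> = ?K\<^sup>2 * ((C + real n)\<^sup>2 + x\<^sup>2)"
    by (simp only: power_mult_distrib power2_abs) (simp only: distrib_left)
  finally have "sqrt ((B + real n)\<^sup>2 + x\<^sup>2) \<le> sqrt (?K\<^sup>2 * ((C + real n)\<^sup>2 + x\<^sup>2))"
    by simp
  then have "norm (of_real B - \<i> * of_real x + of_nat n) \<le> ?K * norm (of_real C - \<i> * of_real x + of_nat n)"
    using K by (simp add: cmod_def real_sqrt_mult)
  then have "norm (pochhammer (of_real B - \<i> * of_real x) n) * norm (of_real B - \<i> * of_real x + of_nat n)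
      \<le> (?K ^ n * norm (pochhammer (of_real C - \<i> * of_real x) n)) * (?K * norm (of_real C - \<i> * of_real x + of_nat n))"
    by (intro mult_mono Suc.IH) auto
  then show ?case
    by (simp add: pochhammer_Suc norm_mult mult_ac)
qed auto

text \<open>The product is Gamma(A + n + i x) or Gamma(A + n - i x), whose modulus is largest on the
  real axis. This is what makes the bounds uniform in x.\<close>

lemma norm_Gamma_pochhammer_le:
  assumes "A > 0" "q > 0"
  shows "norm (Gamma (of_real A + \<i> * of_real x) * pochhammer (of_real A + \<i> * of_real x) n)
      \<le> Gamma A * max 1 (A / q) ^ n * pochhammer q n"
    and "norm (Gamma (of_real A - \<i> * of_real x) * pochhammer (of_real A - \<i> * of_real x) n)
      \<le> Gamma A * max 1 (A / q) ^ n * pochhammer q n"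
proof -
  have A': "A \<notin> \<int>\<^sub>\<le>\<^sub>0" using assms(1) by (auto elim!: nonpos_Ints_cases)
  have "Gamma (A + real n) = Gamma A * pochhammer A n"
    using A' by (simp add: pochhammer_Gamma Gamma_eq_zero_iff)
  also have "pochhammer A n \<le> max 1 (A / q) ^ n * pochhammer q n"
    using norm_pochhammer_le[OF assms(2), of "of_real A" n] assms(1) pochhammer_nonneg[OF assms(1), of n]
    by (simp add: pochhammer_of_real)
  finally have G: "Gamma (A + real n) \<le> Gamma A * max 1 (A / q) ^ n * pochhammer q n"
    using Gamma_real_pos[OF assms(1)] by (simp add: mult.assoc)
  show "norm (Gamma (of_real A + \<i> * of_real x) * pochhammer (of_real A + \<i> * of_real x) n)
      \<le> Gamma A * max 1 (A / q) ^ n * pochhammer q n"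
    using Gamma_mult_pochhammer[of "of_real A + \<i> * of_real x" n] assms(1) G
      norm_Gamma_vertical_le(1)[of "A + real n" x] by (simp add: algebra_simps)
  show "norm (Gamma (of_real A - \<i> * of_real x) * pochhammer (of_real A - \<i> * of_real x) n)
      \<le> Gamma A * max 1 (A / q) ^ n * pochhammer q n"
    using Gamma_mult_pochhammer[of "of_real A - \<i> * of_real x" n] assms(1) G
      norm_Gamma_vertical_le(2)[of "A + real n" x] by (simp add: algebra_simps)
qed

section \<open>The generating function and its termwise bound\<close>

lemma summable_power_over_fact: "summable (\<lambda>n. (r::real) ^ n / fact n)"
  using summable_exp[of r] by (simp add: field_simps)

lemma summable_norm_hypergeo_1F1:
  fixes p z :: complex and q :: real
  assumes "q > 0"
  shows "summable (\<lambda>n. norm (pochhammer p n / pochhammer (of_real q) n * (z ^ n / fact n)))"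
proof (rule summable_comparison_test')
  show "summable (\<lambda>n. (max 1 (norm p / q) * norm z) ^ n / fact n)"
    by (rule summable_power_over_fact)
  fix n
  have pos: "pochhammer q n > 0" using assms by (rule pochhammer_pos)
  have "norm (pochhammer p n / pochhammer (of_real q) n * (z ^ n / fact n))
      = norm (pochhammer p n) / pochhammer q n * (norm z ^ n / fact n)"
    using pos by (simp add: norm_mult norm_divide norm_power pochhammer_of_real)
  also have "\<dots> \<le> max 1 (norm p / q) ^ n * (norm z ^ n / fact n)"
    using norm_pochhammer_le[OF assms, of p n] pos by (intro mult_right_mono) (auto simp: field_simps)
  finally show "norm (norm (pochhammer p n / pochhammer (of_real q) n * (z ^ n / fact n)))
      \<le> (max 1 (norm p / q) * norm z) ^ n / fact n"
    by (simp add: power_mult_distrib)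
qed

text \<open>Equal to \<open>p\<^sub>N(x; A, B) / ((2 A)\<^sub>N (2 B)\<^sub>N)\<close>.\<close>

definition hahn_genfun_coeff :: "real \<Rightarrow> real \<Rightarrow> real \<Rightarrow> nat \<Rightarrow> complex" where
  "hahn_genfun_coeff A B x N = \<i> ^ N *
    (\<Sum>m\<le>N. (-1) ^ m * pochhammer (of_real A + \<i> * of_real x) m * pochhammer (of_real B - \<i> * of_real x) (N - m)
       / (fact m * pochhammer (2 * of_real A) m * fact (N - m) * pochhammer (2 * of_real B) (N - m)))"

lemma hahn_genfun_coeff_term:
  assumes "m \<le> N"
  shows "(pochhammer p m / pochhammer u m * ((- \<i> * \<rho>) ^ m / fact m))
      * (pochhammer r (N - m) / pochhammer v (N - m) * ((\<i> * \<rho>) ^ (N - m) / fact (N - m)))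
    = \<rho> ^ N * (\<i> ^ N * ((-1) ^ m * pochhammer p m * pochhammer r (N - m)
       / (fact m * pochhammer u m * fact (N - m) * pochhammer v (N - m))))"
proof -
  have "(- \<i> * \<rho>) ^ m * (\<i> * \<rho>) ^ (N - m) = (-1) ^ m * ((\<i> * \<rho>) ^ m * (\<i> * \<rho>) ^ (N - m))"
    using power_minus[of "\<i> * \<rho>" m] by simp
  also have "\<dots> = (-1) ^ m * (\<rho> ^ N * \<i> ^ N)"
    using assms by (simp add: power_add[symmetric] power_mult_distrib[symmetric] mult.commute)
  finally have *: "(- \<i> * \<rho>) ^ m * (\<i> * \<rho>) ^ (N - m) = (-1) ^ m * (\<rho> ^ N * \<i> ^ N)" .
  have "(pochhammer p m / pochhammer u m * ((- \<i> * \<rho>) ^ m / fact m))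
      * (pochhammer r (N - m) / pochhammer v (N - m) * ((\<i> * \<rho>) ^ (N - m) / fact (N - m)))
    = ((- \<i> * \<rho>) ^ m * (\<i> * \<rho>) ^ (N - m)) * (pochhammer p m * pochhammer r (N - m)
       / (fact m * pochhammer u m * fact (N - m) * pochhammer v (N - m)))"
    by (simp add: mult_ac)
  then show ?thesis
    unfolding * by simp
qed

lemma hahn_genfun_sums:
  assumes "A > 0" "B > 0"
  shows "(\<lambda>N. \<rho> ^ N * hahn_genfun_coeff A B x N) sums
    (hypergeo [of_real A + \<i> * of_real x] [2 * of_real A] (- \<i> * \<rho>)
     * hypergeo [of_real B - \<i> * of_real x] [2 * of_real B] (\<i> * \<rho>))"
proof -
  let ?f = "\<lambda>m. pochhammer (of_real A + \<i> * of_real x) m / pochhammer (2 * of_real A) m * ((- \<i> * \<rho>) ^ m / fact m)"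
  let ?g = "\<lambda>m. pochhammer (of_real B - \<i> * of_real x) m / pochhammer (2 * of_real B) m * ((\<i> * \<rho>) ^ m / fact m)"
  have "(\<lambda>N. \<Sum>m\<le>N. ?f m * ?g (N - m)) sums (suminf ?f * suminf ?g)"
    using summable_norm_hypergeo_1F1[of "2 * A"] summable_norm_hypergeo_1F1[of "2 * B"] assms
    by (intro Cauchy_product_sums) simp_all
  moreover have "(\<Sum>m\<le>N. ?f m * ?g (N - m)) = \<rho> ^ N * hahn_genfun_coeff A B x N" for N
    unfolding hahn_genfun_coeff_def sum_distrib_left
    by (rule sum.cong[OF refl]) (rule hahn_genfun_coeff_term, simp)
  ultimately show ?thesis
    by (simp add: hypergeo_def)
qed

text \<open>Each of the two Gamma factors tames one of the confluent series, and the bound is a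
  Cauchy product of exponential series, hence summable over N. The maxima in \<open>L\<close> and
  \<open>L'\<close> are the constants of the preceding bounds with q = 2A and q = 2B.\<close>

lemma norm_hahn_genfun_coeff_le:
  fixes A B C L L' :: real and \<rho> :: complex
  assumes "A > 0" "B > 0" "C > 0"
  defines "L \<equiv> norm \<rho> * max 1 (A / (2 * A))" and "L' \<equiv> norm \<rho> * (max 1 (B / C) * max 1 (C / (2 * B)))"
  shows "norm (\<rho> ^ N * hahn_genfun_coeff A B x N * (Gamma (of_real A + \<i> * of_real x) * Gamma (of_real C - \<i> * of_real x)))
    \<le> Gamma A * Gamma C * (\<Sum>m\<le>N. (L ^ m / fact m) * (L' ^ (N - m) / fact (N - m)))"
proof -
  let ?f = "\<lambda>m. pochhammer (of_real A + \<i> * of_real x) m / pochhammer (2 * of_real A) m * ((- \<i> * \<rho>) ^ m / fact m)"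
  let ?g = "\<lambda>m. pochhammer (of_real B - \<i> * of_real x) m / pochhammer (2 * of_real B) m * ((\<i> * \<rho>) ^ m / fact m)"
  have f: "norm (Gamma (of_real A + \<i> * of_real x) * ?f m) \<le> Gamma A * (L ^ m / fact m)" for m
  proof -
    have pos: "pochhammer (2 * A) m > 0" using assms by (intro pochhammer_pos) auto
    have "pochhammer (2 * of_real A) m = complex_of_real (pochhammer (2 * A) m)"
      by (simp flip: pochhammer_of_real)
    then have n: "norm (pochhammer (2 * of_real A :: complex) m) = pochhammer (2 * A) m"
      using pos by simp
    have "norm (Gamma (of_real A + \<i> * of_real x) * ?f m)
        = norm (Gamma (of_real A + \<i> * of_real x) * pochhammer (of_real A + \<i> * of_real x) m)
          / pochhammer (2 * A) m * (norm \<rho> ^ m / fact m)"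
      by (simp add: norm_mult norm_divide norm_power n)
    also have "\<dots> \<le> (Gamma A * max 1 (A / (2 * A)) ^ m) * (norm \<rho> ^ m / fact m)"
      using norm_Gamma_pochhammer_le(1)[of A "2 * A" x m] assms pos
      by (intro mult_right_mono) (auto simp: field_simps)
    also have "\<dots> = Gamma A * (L ^ m / fact m)"
      by (simp add: L_def power_mult_distrib)
    finally show ?thesis .
  qed
  have g: "norm (Gamma (of_real C - \<i> * of_real x) * ?g m) \<le> Gamma C * (L' ^ m / fact m)" for m
  proof -
    have pos: "pochhammer (2 * B) m > 0" using assms by (intro pochhammer_pos) auto
    have "pochhammer (2 * of_real B) m = complex_of_real (pochhammer (2 * B) m)"
      by (simp flip: pochhammer_of_real)
    then have n: "norm (pochhammer (2 * of_real B :: complex) m) = pochhammer (2 * B) m"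
      using pos by simp
    have "norm (Gamma (of_real C - \<i> * of_real x) * pochhammer (of_real B - \<i> * of_real x) m)
       \<le> max 1 (B / C) ^ m * norm (Gamma (of_real C - \<i> * of_real x) * pochhammer (of_real C - \<i> * of_real x) m)"
      using mult_left_mono[OF norm_pochhammer_vertical_le[OF assms(2,3), of x m], of "norm (Gamma (of_real C - \<i> * of_real x))"]
      by (simp add: norm_mult mult_ac)
    also have "\<dots> \<le> max 1 (B / C) ^ m * (Gamma C * max 1 (C / (2 * B)) ^ m * pochhammer (2 * B) m)"
      using norm_Gamma_pochhammer_le(2)[of C "2 * B" x m] assms by (intro mult_left_mono) auto
    finally have *: "norm (Gamma (of_real C - \<i> * of_real x) * pochhammer (of_real B - \<i> * of_real x) m) / pochhammer (2 * B) m
        \<le> Gamma C * (max 1 (B / C) * max 1 (C / (2 * B))) ^ m"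
      using pos by (simp add: pos_divide_le_eq power_mult_distrib mult_ac)
    have "norm (Gamma (of_real C - \<i> * of_real x) * ?g m)
        = norm (Gamma (of_real C - \<i> * of_real x) * pochhammer (of_real B - \<i> * of_real x) m)
          / pochhammer (2 * B) m * (norm \<rho> ^ m / fact m)"
      by (simp add: norm_mult norm_divide norm_power n)
    also have "\<dots> \<le> Gamma C * (max 1 (B / C) * max 1 (C / (2 * B))) ^ m * (norm \<rho> ^ m / fact m)"
      by (intro mult_right_mono *) auto
    also have "\<dots> = Gamma C * (L' ^ m / fact m)"
      by (simp add: L'_def power_mult_distrib)
    finally show ?thesis .
  qed
  define u v where "u = (\<lambda>m. Gamma (of_real A + \<i> * of_real x) * ?f m)"
    and "v = (\<lambda>m. Gamma (of_real C - \<i> * of_real x) * ?g m)"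
  define p q where "p = (\<lambda>m. L ^ m / fact m)" and "q = (\<lambda>m. L' ^ m / fact m)"
  have u: "norm (u m) \<le> Gamma A * p m" and v: "norm (v m) \<le> Gamma C * q m" for m
    unfolding u_def v_def p_def q_def by (rule f, rule g)
  have swap: "y * z * (Y * Z) = (Y * y) * (Z * z)" for y z Y Z :: complex
    by simp
  have "\<rho> ^ N * hahn_genfun_coeff A B x N = (\<Sum>m\<le>N. ?f m * ?g (N - m))"
    unfolding hahn_genfun_coeff_def sum_distrib_left
    by (rule sum.cong[OF refl]) (rule hahn_genfun_coeff_term[symmetric], simp)
  then have "\<rho> ^ N * hahn_genfun_coeff A B x N * (Gamma (of_real A + \<i> * of_real x) * Gamma (of_real C - \<i> * of_real x))
     = (\<Sum>m\<le>N. u m * v (N - m))"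
    by (simp only: sum_distrib_right swap u_def v_def)
  also have "norm (\<Sum>m\<le>N. u m * v (N - m)) \<le> (\<Sum>m\<le>N. (Gamma A * p m) * (Gamma C * q (N - m)))"
  proof (rule sum_norm_le)
    fix m
    show "norm (u m * v (N - m)) \<le> (Gamma A * p m) * (Gamma C * q (N - m))"
      unfolding norm_mult by (rule mult_mono[OF u v order_trans[OF norm_ge_zero u] norm_ge_zero])
  qed
  also have "\<dots> = Gamma A * Gamma C * (\<Sum>m\<le>N. p m * q (N - m))"
    by (simp add: sum_distrib_left mult_ac)
  finally show ?thesis
    unfolding p_def q_def .
qed

text \<open>The separated majorant \<open>c n * U x\<close> gives both conditions for termwise
  integration: absolute convergence at each x, and summability of the integrals of the norms.
  Summability of \<open>I\<close> is recorded because it later yields convergence of the power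
  series in rho.\<close>

lemma has_bochner_integral_sums:
  fixes f :: "nat \<Rightarrow> 'a \<Rightarrow> 'b::{banach, second_countable_topology}"
  assumes f: "\<And>n. has_bochner_integral M (f n) (I n)"
    and bound: "\<And>n x. norm (f n x) \<le> c n * U x"
    and U: "integrable M U" and c: "summable c"
    and F: "\<And>x. (\<lambda>n. f n x) sums F x"
  shows "summable I" and "has_bochner_integral M F (suminf I)"
proof -
  have int: "integrable M (f n)" and I: "integral\<^sup>L M (f n) = I n" for n
    using f by (auto simp: has_bochner_integral_iff)
  have s1: "AE x in M. summable (\<lambda>n. norm (f n x))"
  proof (rule AE_I2)
    fix x
    show "summable (\<lambda>n. norm (f n x))"
      by (rule summable_comparison_test'[of "\<lambda>n. c n * U x"])
        (use bound c in \<open>auto intro: summable_mult2\<close>)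
  qed
  have s2: "summable (\<lambda>n. \<integral>x. norm (f n x) \<partial>M)"
  proof (rule summable_comparison_test'[of "\<lambda>n. c n * integral\<^sup>L M U"])
    show "summable (\<lambda>n. c n * integral\<^sup>L M U)" using c by (rule summable_mult2)
    fix n
    have "(\<integral>x. norm (f n x) \<partial>M) \<le> (\<integral>x. c n * U x \<partial>M)"
      using int U bound by (intro integral_mono) auto
    then show "norm (\<integral>x. norm (f n x) \<partial>M) \<le> c n * integral\<^sup>L M U"
      using U by simp
  qed
  have F': "F = (\<lambda>x. \<Sum>n. f n x)"
    using F by (auto simp: sums_iff)
  show "summable I"
    using summable_integral[OF int s1 s2] by (simp add: I)
  show "has_bochner_integral M F (suminf I)"
    unfolding F' has_bochner_integral_iff
    using integrable_suminf[OF int s1 s2] integral_suminf[OF int s1 s2] by (simp add: I)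
qed

lemma integrable_Gamma_Gamma_cont_hahn:
  assumes A: "A > 0" and C: "C > 0"
  shows "integrable lborel (\<lambda>x. norm (Gamma (of_real A - \<i> * of_real x) * Gamma (of_real C + \<i> * of_real x)
      * cont_hahn k (of_real x) (of_real A) (of_real C)))"
proof (rule integrable_norm)
  define pre where "pre = (- \<i>) ^ k * (pochhammer (2 * of_real C) k * pochhammer (of_real A + of_real C) k / fact k)"
  define co :: "nat \<Rightarrow> complex" where "co = (\<lambda>l. of_nat (k choose l) * (-1) ^ l
        * pochhammer (of_nat k + (2 * of_real A + 2 * of_real C) - 1) l
        / (pochhammer (2 * of_real C) l * pochhammer (of_real A + of_real C) l))"
  have "integrable lborel (\<lambda>x. Gamma (of_real A - \<i> * of_real x) * Gamma (of_real C + \<i> * of_real x)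
      * pochhammer (of_real C - \<i> * of_real x) l)" for l
  proof (rule Bochner_Integration.integrable_bound)
    show "integrable lborel (\<lambda>x. Gamma (of_real (C + real l) + \<i> * of_real x) * Gamma (of_real A - \<i> * of_real x))"
      using assms by (intro integrable_Gamma_Gamma) auto
    have [measurable]: "(\<lambda>x. pochhammer (of_real C - \<i> * of_real x) l) \<in> borel_measurable borel"
      unfolding pochhammer_prod by (intro borel_measurable_continuous_onI continuous_intros)
    show "(\<lambda>x. Gamma (of_real A - \<i> * of_real x) * Gamma (of_real C + \<i> * of_real x)
      * pochhammer (of_real C - \<i> * of_real x) l) \<in> borel_measurable lborel"
      using assms by measurable
    \<comment> \<open>Conjugation does not change the modulus, so the symbol can be absorbed by the
      factor Gamma(C + i x), which has the opposite sign of x.\<close>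
    have "norm (pochhammer (of_real C - \<i> * of_real x) l) = norm (pochhammer (of_real C + \<i> * of_real x) l)" for x
    proof -
      have "pochhammer (of_real C - \<i> * of_real x) l = cnj (pochhammer (of_real C + \<i> * of_real x) l)"
        by (simp add: pochhammer_prod)
      then show ?thesis by (metis complex_mod_cnj)
    qed
    moreover have "Gamma (of_real C + \<i> * of_real x) * pochhammer (of_real C + \<i> * of_real x) l
        = Gamma (of_real (C + real l) + \<i> * of_real x)" for x
      using Gamma_mult_pochhammer[of "of_real C + \<i> * of_real x" l] C by (simp add: add_ac)
    ultimately have "norm (Gamma (of_real C + \<i> * of_real x)) * norm (pochhammer (of_real C - \<i> * of_real x) l)
        = norm (Gamma (of_real (C + real l) + \<i> * of_real x))" for x
      by (metis norm_mult)
    then show "AE x in lborel. norm (Gamma (of_real A - \<i> * of_real x) * Gamma (of_real C + \<i> * of_real x)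
        * pochhammer (of_real C - \<i> * of_real x) l)
      \<le> norm (Gamma (of_real (C + real l) + \<i> * of_real x) * Gamma (of_real A - \<i> * of_real x))"
      by (simp add: norm_mult mult_ac)
  qed
  then have "integrable lborel (\<lambda>x. \<Sum>l\<le>k. pre * co l * (Gamma (of_real A - \<i> * of_real x) * Gamma (of_real C + \<i> * of_real x)
      * pochhammer (of_real C - \<i> * of_real x) l))"
    by (intro Bochner_Integration.integrable_sum integrable_mult_right)
  also have "(\<lambda>x. \<Sum>l\<le>k. pre * co l * (Gamma (of_real A - \<i> * of_real x) * Gamma (of_real C + \<i> * of_real x)
      * pochhammer (of_real C - \<i> * of_real x) l))
    = (\<lambda>x. Gamma (of_real A - \<i> * of_real x) * Gamma (of_real C + \<i> * of_real x)
      * cont_hahn k (of_real x) (of_real A) (of_real C))"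
    unfolding cont_hahn_eq_sum_swap[OF A C] pre_def co_def by (simp add: sum_distrib_left mult_ac)
  finally show "integrable lborel (\<lambda>x. Gamma (of_real A - \<i> * of_real x) * Gamma (of_real C + \<i> * of_real x)
      * cont_hahn k (of_real x) (of_real A) (of_real C))" .
qed

section \<open>Evaluation of the coefficients\<close>

lemma hahn_genfun_coeff_eq_sum:
  fixes A B :: real and a b :: complex
  assumes A: "A > 0" and B: "B > 0"
  defines "a \<equiv> of_real A" and "b \<equiv> of_real B"
  shows "hahn_genfun_coeff A B x N = \<i> ^ N * (pochhammer (a + b) N / (fact N * pochhammer (2 * b) N)) *
    (\<Sum>j\<le>N. of_nat (N choose j) * (-1) ^ j * pochhammer (of_nat N + 2 * (a + b) - 1) j
        * pochhammer (a + \<i> * of_real x) j / (pochhammer (2 * a) j * pochhammer (a + b) j))"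
proof -
  have np: "2 * a \<notin> \<int>\<^sub>\<le>\<^sub>0" "2 * b \<notin> \<int>\<^sub>\<le>\<^sub>0" "a + b \<notin> \<int>\<^sub>\<le>\<^sub>0"
    using notin_nonpos_Ints_of_real[of "2 * A"] notin_nonpos_Ints_of_real[of "2 * B"]
      notin_nonpos_Ints_of_real[of "A + B"] A B by (simp_all add: a_def b_def)
  show ?thesis
    using convolution_sum_transform[OF np, where N = N and y = "a + \<i> * of_real x"]
    by (simp add: hahn_genfun_coeff_def a_def b_def algebra_simps)
qed

text \<open>The (2a)_j of the moment cancels against the (2a)_j in the expansion of the generating
  coefficient, which leaves \<open>hahn_connection_sum\<close> with s = a + b and \<tau> = a +
  c.\<close>

lemma hahn_genfun_coeff_integral:
  fixes A B C :: real and a b c :: complex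
  assumes A: "A > 0" and B: "B > 0" and C: "C > 0"
  defines "a \<equiv> of_real A" and "b \<equiv> of_real B" and "c \<equiv> of_real C"
  shows "has_bochner_integral lborel
    (\<lambda>x. hahn_weight A C x * hahn_genfun_coeff A B x N * cont_hahn k (of_real x) a c)
    (\<i> ^ N * (- \<i>) ^ k
      * (2 * pi * (Gamma (2 * a) * Gamma (a + c) ^ 2 * Gamma (2 * c) / Gamma (2 * (a + c))))
      * (pochhammer (2 * c) k * pochhammer (a + c) k)
      * (pochhammer (a + b) N / (fact N * pochhammer (2 * b) N)
         * (of_nat (N choose k) * pochhammer (of_nat N + 2 * (a + b) - 1) k * pochhammer (a + c) k
            / (pochhammer (a + b) k * pochhammer (2 * (a + c)) (2 * k)))
         * watson_sum (a + b + of_nat k) (a + c + of_nat k) (N - k)))"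
proof -
  have "2 * a \<notin> \<int>\<^sub>\<le>\<^sub>0"
    using notin_nonpos_Ints_of_real[of "2 * A"] A by (simp add: a_def)
  note nz = pochhammer_nonzero(1)[OF this]
  define pre where "pre = \<i> ^ N * (pochhammer (a + b) N / (fact N * pochhammer (2 * b) N))"
  define co where "co = (\<lambda>j. of_nat (N choose j) * (-1) ^ j * pochhammer (of_nat N + 2 * (a + b) - 1) j
        / (pochhammer (2 * a) j * pochhammer (a + b) j))"
  define K where "K = (- \<i>) ^ k * (pochhammer (2 * c) k * pochhammer (a + c) k / fact k)
      * (2 * pi * (Gamma (2 * a) * Gamma (a + c) ^ 2 * Gamma (2 * c) / Gamma (2 * (a + c))))"
  have "has_bochner_integral lborel
      (\<lambda>x. \<Sum>j\<le>N. pre * co j * (hahn_weight A C x * pochhammer (a + \<i> * of_real x) j * cont_hahn k (of_real x) a c))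
      (\<Sum>j\<le>N. pre * co j * (K * (pochhammer (2 * a) j * pochhammer (a + c) j * pochhammer (- of_nat j) k
          / pochhammer (2 * (a + c)) (j + k))))"
    unfolding a_def c_def K_def
    by (intro has_bochner_integral_sum has_bochner_integral_mult_right hahn_weight_pochhammer_cont_hahn A C)
  also have "(\<lambda>x. \<Sum>j\<le>N. pre * co j * (hahn_weight A C x * pochhammer (a + \<i> * of_real x) j * cont_hahn k (of_real x) a c))
      = (\<lambda>x. hahn_weight A C x * hahn_genfun_coeff A B x N * cont_hahn k (of_real x) a c)"
    unfolding a_def hahn_genfun_coeff_eq_sum[OF A B]
    by (simp add: pre_def co_def a_def b_def sum_distrib_left sum_distrib_right mult_ac)
  also have "(\<Sum>j\<le>N. pre * co j * (K * (pochhammer (2 * a) j * pochhammer (a + c) j * pochhammer (- of_nat j) k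
          / pochhammer (2 * (a + c)) (j + k))))
     = pre * K * (\<Sum>j\<le>N. of_nat (N choose j) * (-1) ^ j * pochhammer (of_nat N + 2 * (a + b) - 1) j
      * pochhammer (a + c) j * pochhammer (- of_nat j) k / (pochhammer (a + b) j * pochhammer (2 * (a + c)) (j + k)))"
    unfolding sum_distrib_left
    by (intro sum.cong refl) (use nz in \<open>simp add: co_def mult_ac\<close>)
  also have "\<dots> = \<i> ^ N * (- \<i>) ^ k
      * (2 * pi * (Gamma (2 * a) * Gamma (a + c) ^ 2 * Gamma (2 * c) / Gamma (2 * (a + c))))
      * (pochhammer (2 * c) k * pochhammer (a + c) k)
      * (pochhammer (a + b) N / (fact N * pochhammer (2 * b) N)
         * (of_nat (N choose k) * pochhammer (of_nat N + 2 * (a + b) - 1) k * pochhammer (a + c) k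
            / (pochhammer (a + b) k * pochhammer (2 * (a + c)) (2 * k)))
         * watson_sum (a + b + of_nat k) (a + c + of_nat k) (N - k))"
    unfolding hahn_connection_sum pre_def K_def by (simp add: mult_ac)
  finally show ?thesis .
qed

lemma pochhammer_double_power4:
  fixes z :: "'a::field_char_0"
  shows "pochhammer (2 * z) (2 * n) = 4 ^ n * pochhammer z n * pochhammer (z + 1/2) n"
  by (simp add: pochhammer_double power_mult)

text \<open>Each symbol of index N is split at k, and its part of length 2j is halved by the
  duplication formula; this is the origin of the half-integer shifts in the 4F5. The factor (1/2)_j
  of Watson's sum cancels against (2j)! = 4^j (1/2)_j j!. \<open>R\<close> is the parameter pair
  that is cancelled at k = 0.\<close>

lemma hahn_coefficient_pochhammer_identity:
  fixes s b :: "'a::field_char_0" and k j :: nat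
  assumes s: "s \<notin> \<int>\<^sub>\<le>\<^sub>0" "2 * s \<notin> \<int>\<^sub>\<le>\<^sub>0" and b: "2 * b \<notin> \<int>\<^sub>\<le>\<^sub>0"
  defines "N \<equiv> k + 2 * j" and "R \<equiv> (if k = 0 then 1 else pochhammer (s + of_nat k - 1/2) j / pochhammer (s + (of_nat k - 1) / 2) j)"
  shows "pochhammer s N / (fact N * pochhammer (2 * b) N)
         * (of_nat (N choose k) * pochhammer (of_nat N + 2 * s - 1) k / pochhammer s k)
         * (pochhammer (1/2) j / pochhammer (s + of_nat k) j)
       = pochhammer (of_nat k + 2 * s - 1) k / (fact k * pochhammer (2 * b) k)
         * (pochhammer ((s + of_nat k) / 2) j * pochhammer ((s + of_nat k + 1) / 2) j * R
            / (pochhammer (s + of_nat k / 2) j * pochhammer (b + of_nat k / 2) j * pochhammer (b + (of_nat k + 1) / 2) j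
               * (4 ^ j * fact j)))"
proof -
  define q :: 'a where "q = of_nat k"
  have sq: "s + q \<notin> \<int>\<^sub>\<le>\<^sub>0" and sq2: "2 * s + q \<notin> \<int>\<^sub>\<le>\<^sub>0" and bq2: "2 * b + q \<notin> \<int>\<^sub>\<le>\<^sub>0"
    unfolding q_def by (intro add_of_nat_notin_nonpos_Ints s b)+
  have e1: "pochhammer s N = pochhammer s k * (4 ^ j * pochhammer ((s + q) / 2) j * pochhammer ((s + q + 1) / 2) j)"
    using pochhammer_double_power4[of "(s + q) / 2" j] by (simp add: N_def pochhammer_product' q_def add_divide_distrib)
  have e2': "pochhammer (2 * b + q) (2 * j) = 4 ^ j * pochhammer (b + q / 2) j * pochhammer (b + (q + 1) / 2) j"
    using pochhammer_double_power4[of "b + q / 2" j] by (simp add: distrib_left add_divide_distrib add.assoc)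
  have e2: "pochhammer (2 * b) N = pochhammer (2 * b) k * (4 ^ j * pochhammer (b + q / 2) j * pochhammer (b + (q + 1) / 2) j)"
    using e2' by (simp add: N_def pochhammer_product' q_def)
  have "fact (2 * j) = (4 ^ j * pochhammer (1/2) j * fact j :: 'a)"
    by (simp only: fact_double power_mult power2_eq_square) simp
  then have e3: "of_nat (N choose k) / fact N = (1 / (fact k * (4 ^ j * pochhammer (1/2) j * fact j)) :: 'a)"
    by (simp add: N_def binomial_fact)
  have half: "pochhammer (1/2) j \<noteq> (0::'a)"
    using fact_double[of j, where 'a = 'a] fact_nonzero[of "2 * j", where 'a = 'a] by auto
  have nz: "pochhammer s k \<noteq> 0" "pochhammer (2 * b) k \<noteq> 0" "pochhammer (s + q) j \<noteq> 0"
      "pochhammer (b + q / 2) j \<noteq> 0" "pochhammer (b + (q + 1) / 2) j \<noteq> 0"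
    using pochhammer_nonzero(1)[OF s(1)] pochhammer_nonzero(1)[OF b] pochhammer_nonzero(1)[OF sq]
      pochhammer_nonzero(1)[OF bq2, of "2 * j"] e2' by auto
  have nz2: "pochhammer (s + q / 2) j \<noteq> 0"
    using pochhammer_nonzero(1)[OF sq2, of "2 * j"] pochhammer_double_power4[of "s + q / 2" j]
    by (auto simp: distrib_left)
  \<comment> \<open>With u = 2s + k - 1, the symbol (u)_(2j+k) is split once after 2j and once after
    k factors, and the parts of length 2j are halved. For k > 0, u = 2s + (k - 1) is admissible; for
    k = 0 it may vanish, but then both sides agree trivially.\<close>
  have e5: "pochhammer (of_nat N + 2 * s - 1) k / pochhammer (s + q) j
      = pochhammer (q + 2 * s - 1) k * R / pochhammer (s + q / 2) j"
  proof (cases "k = 0")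
    case True
    then show ?thesis by (simp add: R_def q_def)
  next
    case False
    define u where "u = 2 * s + q - 1"
    have "2 * s + of_nat (k - 1) \<notin> \<int>\<^sub>\<le>\<^sub>0" by (intro add_of_nat_notin_nonpos_Ints s)
    moreover have "2 * s + of_nat (k - 1) = u"
      using False by (simp add: u_def q_def of_nat_diff)
    ultimately have u: "u \<notin> \<int>\<^sub>\<le>\<^sub>0" by simp
    have u1: "pochhammer u (2 * j) = 4 ^ j * pochhammer (s + (q - 1) / 2) j * pochhammer (s + q / 2) j"
      using pochhammer_double_power4[of "s + (q - 1) / 2" j]
      by (simp add: u_def distrib_left diff_divide_distrib add_diff_eq)
    have u2: "pochhammer (u + q) (2 * j) = 4 ^ j * pochhammer (s + q - 1/2) j * pochhammer (s + q) j"
    proof -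
      have "u + q = 2 * (s + q - 1/2)" by (simp add: u_def algebra_simps)
      moreover have "s + q - 1/2 + 1/2 = s + q" by simp
      ultimately show ?thesis by (simp only: pochhammer_double_power4)
    qed
    have e: "pochhammer u (2 * j) * pochhammer (u + 2 * of_nat j) k = pochhammer u k * pochhammer (u + q) (2 * j)"
      using pochhammer_product'[of u "2 * j" k] pochhammer_product'[of u k "2 * j"]
      by (simp add: q_def add.commute)
    have e': "u + 2 * of_nat j = of_nat N + 2 * s - 1" "u = q + 2 * s - 1"
      by (simp_all add: u_def q_def N_def)
    have main: "4 ^ j * pochhammer (s + (q - 1) / 2) j * pochhammer (s + q / 2) j
          * pochhammer (of_nat N + 2 * s - 1) k
        = pochhammer (q + 2 * s - 1) k * (4 ^ j * pochhammer (s + q - 1/2) j * pochhammer (s + q) j)"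
      using e unfolding u1 u2 e'(1) unfolding e'(2) .
    have "pochhammer (s + (q - 1) / 2) j \<noteq> 0"
      using pochhammer_nonzero(1)[OF u, of "2 * j"] u1 by auto
    moreover have "P / W = p * (X / Y) / Z"
      if "4 ^ j * Y * Z * P = p * (4 ^ j * X * W)" "Y \<noteq> 0" "Z \<noteq> 0" "W \<noteq> 0" for P W p X Y Z :: 'a
      using that by (simp add: field_simps)
    ultimately show ?thesis
      using main False nz(3) nz2 by (simp only: R_def q_def[symmetric] if_False)
  qed
  \<comment> \<open>Stated for free variables, so that rewriting treats each Pochhammer symbol as an
    atom and cannot rearrange its parameters.\<close>
  have cancel: "(1 / (fk * (F * h * fj))) * ((sk * (F * x * y)) / (sk * (bk * (F * d2 * d3)))) * h * (p * r / d1)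
      = p / (fk * bk) * (x * y * r / (d1 * d2 * d3 * (F * fj)))"
    if "sk \<noteq> 0" "F \<noteq> 0" "h \<noteq> 0" for fk F h fj sk x y bk d1 d2 d3 p r :: 'a
  proof -
    have "(1 / (fk * (F * h * fj))) * ((sk * (F * x * y)) / (sk * (bk * (F * d2 * d3)))) * h * (p * r / d1)
      = p / (fk * bk) * (x * y * r / (d1 * d2 * d3 * (F * fj)))
        * ((sk * inverse sk) * ((F * inverse F) * (h * inverse h)))"
      by (simp only: divide_inverse inverse_mult_distrib mult_ac mult_1_left)
    also have "(sk * inverse sk) * ((F * inverse F) * (h * inverse h)) = 1"
      using that by simp
    finally show ?thesis by (simp only: mult_1_right)
  qed
  have "pochhammer s N / (fact N * pochhammer (2 * b) N)
         * (of_nat (N choose k) * pochhammer (of_nat N + 2 * s - 1) k / pochhammer s k)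
         * (pochhammer (1/2) j / pochhammer (s + q) j)
     = (of_nat (N choose k) / fact N) * (pochhammer s N / (pochhammer s k * pochhammer (2 * b) N))
        * pochhammer (1/2) j * (pochhammer (of_nat N + 2 * s - 1) k / pochhammer (s + q) j)"
    by (simp only: divide_inverse inverse_mult_distrib mult_ac)
  also have "\<dots> = pochhammer (q + 2 * s - 1) k / (fact k * pochhammer (2 * b) k)
         * (pochhammer ((s + q) / 2) j * pochhammer ((s + q + 1) / 2) j * R
            / (pochhammer (s + q / 2) j * pochhammer (b + q / 2) j * pochhammer (b + (q + 1) / 2) j
               * (4 ^ j * fact j)))"
    unfolding e5 e3 e1 e2 by (rule cancel) (use nz half in auto)
  finally show ?thesis
    unfolding q_def .
qed

text \<open>By duplication, (T/2)_k equals (T)_(2k) divided by 4^k ((T + 1)/2)_k. Then (2k + T)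
  completes (T)_(2k) to (T)_(2k+1), whose first factor T turns Gamma(T) into Gamma(T + 1). The
  resulting expression is continuous at T = 0, so it also gives the limit.\<close>

lemma degen_factor_eq:
  fixes T :: real
  assumes T: "T > - 1"
  shows "degen_factor k (of_real T) = Gamma (of_real T + 1) * pochhammer (of_real T + 1) (2 * k)
      / (4 ^ k * pochhammer ((of_real T + 1) / 2) k)"
proof -
  define f where "f = (\<lambda>t::complex. (2 * of_nat k + t) * Gamma t * pochhammer (t / 2) k)"
  define g where "g = (\<lambda>t::complex. Gamma (t + 1) * pochhammer (t + 1) (2 * k) / (4 ^ k * pochhammer ((t + 1) / 2) k))"
  have nonint: "t \<notin> \<int>\<^sub>\<le>\<^sub>0" if "t \<noteq> 0" "Re t > -1" for t :: complex
    using that by (auto elim!: nonpos_Ints_cases')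
  have nz: "pochhammer ((t + 1) / 2) k \<noteq> 0" if "Re t > - 1" for t :: complex
  proof -
    have "(t + 1) / 2 \<notin> \<int>\<^sub>\<le>\<^sub>0"
    proof
      assume "(t + 1) / 2 \<in> \<int>\<^sub>\<le>\<^sub>0"
      then obtain n where "(t + 1) / 2 = - of_nat n" by (elim nonpos_Ints_cases')
      then have "Re ((t + 1) / 2) \<le> 0" by simp
      with that show False by simp
    qed
    then show ?thesis by (rule pochhammer_nonzero)
  qed
  have fg: "f t = g t" if "t \<noteq> 0" "Re t > -1" for t
  proof -
    have t: "t \<notin> \<int>\<^sub>\<le>\<^sub>0" by (rule nonint[OF that])
    have "4 ^ k * pochhammer ((t + 1) / 2) k * f t
        = (t + of_nat (2 * k)) * Gamma t * (4 ^ k * pochhammer (t / 2) k * pochhammer (t / 2 + 1/2) k)"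
      by (simp add: f_def add_divide_distrib add.commute)
    also have "\<dots> = Gamma t * pochhammer t (Suc (2 * k))"
      using pochhammer_double_power4[of "t / 2" k] by (simp add: pochhammer_Suc)
    also have "\<dots> = Gamma (t + 1) * pochhammer (t + 1) (2 * k)"
      using Gamma_plus1[OF t] by (simp add: pochhammer_rec)
    finally show ?thesis
      using nz[OF that(2)] by (simp add: g_def field_simps)
  qed
  show ?thesis
  proof (cases "T = 0")
    case False
    then show ?thesis
      using fg[of "of_real T"] T by (simp add: degen_factor_def f_def g_def)
  next
    case True
    have np: "1 \<notin> (\<int>\<^sub>\<le>\<^sub>0 :: complex set)" using notin_nonpos_Ints_of_real[of 1] by simp
    have "isCont g 0"
      unfolding g_def pochhammer_prod using nz[of 0, unfolded pochhammer_prod] np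
      by (intro continuous_intros) auto
    then have "g \<midarrow>0\<rightarrow> g 0" by (simp add: isCont_def)
    moreover have "\<forall>\<^sub>F t in at 0. g t = f t"
      unfolding eventually_at
    \<comment> \<open>Within radius 1 the real part stays above -1, where 0 is the only pole of
      Gamma.\<close>
    proof (intro exI[of _ 1] conjI ballI impI)
      fix t :: complex assume "t \<noteq> 0 \<and> dist t 0 < 1"
      moreover have "\<bar>Re t\<bar> \<le> norm t" by (rule abs_Re_le_cmod)
      ultimately show "g t = f t" by (intro fg[symmetric]) auto
    qed simp
    ultimately have "f \<midarrow>0\<rightarrow> g 0" using tendsto_cong by blast
    then have "Lim (at 0) f = g 0" by (intro tendsto_Lim) auto
    then show ?thesis
      using True by (simp add: degen_factor_def f_def g_def)
  qed
qed

text \<open>For c = 0 both sides are 0, whatever value \<open>suminf\<close> takes; otherwise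
  convergence of \<open>t\<close> is inherited. Convergence of the 4F5 series thus comes from the
  exchange wherever its value matters.\<close>

lemma sums_mult_imp_eq_mult_suminf:
  fixes c S :: "'a::real_normed_field"
  assumes "(\<lambda>n. c * t n) sums S"
  shows "S = c * suminf t"
proof (cases "c = 0")
  case True
  then show ?thesis using assms by (simp add: sums_unique2[OF _ sums_zero])
next
  case False
  then have "summable t" using assms summable_mult_D sums_summable by blast
  then have "(\<lambda>n. c * t n) sums (c * suminf t)" by (intro sums_mult summable_sums)
  then show ?thesis using assms sums_unique2 by blast
qed

text \<open>\<open>Q\<close>, from Watson's sum, carries the parameters b - c and a + c + k + 1/2.
  The sign (-1)^j comes from the powers of i, and the 4^j below j! combines with it and rho^(2j) to
  the argument -rho^2/4. The 4^k that turns rho^k into (rho/4)^k is the one in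
  \<open>degen_factor_eq\<close>.\<close>

lemma hahn_coefficient_term:
  fixes A B C :: real and a b c \<rho> :: complex and k j :: nat
  assumes A: "A > 0" and B: "B > 0" and C: "C > 0"
  defines "a \<equiv> of_real A" and "b \<equiv> of_real B" and "c \<equiv> of_real C" and "N \<equiv> k + 2 * j"
  defines "as \<equiv> [(a + b + of_nat k) / 2, (a + b + of_nat k + 1) / 2]
        @ (if k = 0 then [] else [a + b + of_nat k - 1/2]) @ [b - c]"
    and "bs \<equiv> (if k = 0 then [] else [a + b + (of_nat k - 1) / 2])
        @ [a + b + of_nat k / 2, b + of_nat k / 2, b + (of_nat k + 1) / 2, a + c + of_nat k + 1/2]"
  shows "\<rho> ^ N * (\<i> ^ N * (- \<i>) ^ k
      * (2 * pi * (Gamma (2 * a) * Gamma (a + c) ^ 2 * Gamma (2 * c) / Gamma (2 * (a + c))))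
      * (pochhammer (2 * c) k * pochhammer (a + c) k)
      * (pochhammer (a + b) N / (fact N * pochhammer (2 * b) N)
         * (of_nat (N choose k) * pochhammer (of_nat N + 2 * (a + b) - 1) k * pochhammer (a + c) k
            / (pochhammer (a + b) k * pochhammer (2 * (a + c)) (2 * k)))
         * watson_sum (a + b + of_nat k) (a + c + of_nat k) (N - k)))
    = (2 * pi * (Gamma (2 * a) * Gamma (a + c) ^ 2 * Gamma (2 * c)
          * pochhammer (of_nat k + 2 * a + 2 * b - 1) k * pochhammer (a + c) k * pochhammer (2 * c) k * (\<rho> / 4) ^ k)
        / (fact k * degen_factor k (2 * a + 2 * c - 1) * pochhammer (2 * b) k))
      * (prod_list (map (\<lambda>a. pochhammer a j) as) / prod_list (map (\<lambda>b. pochhammer b j) bs)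
         * ((- (\<rho>\<^sup>2 / 4)) ^ j / fact j))"
proof -
  define s where "s = a + b"
  define \<tau> where "\<tau> = a + c"
  have s: "s \<notin> \<int>\<^sub>\<le>\<^sub>0" "2 * s \<notin> \<int>\<^sub>\<le>\<^sub>0" and b2: "2 * b \<notin> \<int>\<^sub>\<le>\<^sub>0"
    and \<tau>: "\<tau> \<notin> \<int>\<^sub>\<le>\<^sub>0" "2 * \<tau> \<notin> \<int>\<^sub>\<le>\<^sub>0"
    using notin_nonpos_Ints_of_real[of "A + B"] notin_nonpos_Ints_of_real[of "2 * (A + B)"]
      notin_nonpos_Ints_of_real[of "2 * B"] notin_nonpos_Ints_of_real[of "A + C"]
      notin_nonpos_Ints_of_real[of "2 * (A + C)"] A B C
    by (simp_all add: s_def \<tau>_def a_def b_def c_def)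
  have sk: "s + of_nat k \<notin> \<int>\<^sub>\<le>\<^sub>0" by (rule add_of_nat_notin_nonpos_Ints[OF s(1)])
  have "2 * s + of_nat (2 * k) \<notin> \<int>\<^sub>\<le>\<^sub>0" "2 * \<tau> + of_nat (2 * k) \<notin> \<int>\<^sub>\<le>\<^sub>0"
    by (intro add_of_nat_notin_nonpos_Ints s \<tau>)+
  then have sk2: "2 * (s + of_nat k) \<notin> \<int>\<^sub>\<le>\<^sub>0" and \<tau>k2: "2 * (\<tau> + of_nat k) \<notin> \<int>\<^sub>\<le>\<^sub>0"
    by (simp_all add: distrib_left)
  define R where "R = (if k = 0 then 1 else pochhammer (s + of_nat k - 1/2) j / pochhammer (s + (of_nat k - 1) / 2) j)"
  define Q where "Q = pochhammer (b - c) j / pochhammer (\<tau> + of_nat k + 1/2) j"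
  define E where "E = 2 * pi * (Gamma (2 * a) * Gamma \<tau> ^ 2 * Gamma (2 * c))"
  have W: "watson_sum (s + of_nat k) (\<tau> + of_nat k) (N - k)
      = pochhammer (1/2) j / pochhammer (s + of_nat k) j * Q"
  proof -
    have "N - k = 2 * j" "s + of_nat k - (\<tau> + of_nat k) = b - c"
      by (simp_all add: N_def s_def \<tau>_def)
    then show ?thesis
      using watson_sum_odd_even(2)[OF sk2 sk \<tau>k2, of j] by (simp add: Q_def)
  qed
  \<comment> \<open>Here T = 2\<tau> - 1, so T + 1 = 2\<tau>, and T > -1 because A and C are
    positive.\<close>
  have D: "degen_factor k (2 * a + 2 * c - 1) = Gamma (2 * \<tau>) * pochhammer (2 * \<tau>) (2 * k) / (4 ^ k * pochhammer \<tau> k)"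
    using degen_factor_eq[of "2 * A + 2 * C - 1" k] A C by (simp add: \<tau>_def a_def c_def distrib_left add_divide_distrib)
  have q: "of_nat k + 2 * s - 1 = of_nat k + 2 * a + 2 * b - 1"
    by (simp add: s_def algebra_simps)
  have "\<i> ^ N * (- \<i>) ^ k = (\<i> * - \<i>) ^ k * (\<i>\<^sup>2) ^ j"
    by (simp only: N_def power_add power_mult) (simp only: power_mult_distrib mult_ac)
  then have i: "\<i> ^ N * (- \<i>) ^ k = (-1) ^ j" by simp
  have "4 ^ k * (\<rho> / 4) ^ k * (4 ^ j * (- (\<rho>\<^sup>2 / 4)) ^ j) = (4 * (\<rho> / 4)) ^ k * (4 * (- (\<rho>\<^sup>2 / 4))) ^ j"
    by (simp only: power_mult_distrib)
  also have "\<dots> = \<rho> ^ k * ((\<rho>\<^sup>2) * (-1)) ^ j" by simp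
  also have "\<dots> = \<rho> ^ N * (-1) ^ j"
    by (simp only: N_def power_add power_mult) (simp only: power_mult_distrib mult_ac)
  finally have r: "\<rho> ^ N * (-1) ^ j = 4 ^ k * (\<rho> / 4) ^ k * (4 ^ j * (- (\<rho>\<^sup>2 / 4)) ^ j)" ..
  have gen: "\<rho> ^ N * (i' * (E / Gamma (2 * \<tau>)) * (pc * pt) * (X1 * (X2 * pt / (X3 * X4)) * (X5 * Q)))
     = (\<rho> ^ N * i') * (E / Gamma (2 * \<tau>)) * (pc * pt) * (pt / X4 * Q) * (X1 * (X2 / X3) * X5)"
    for i' pc pt X1 X2 X3 X4 X5 :: complex
    by (simp only: divide_inverse inverse_mult_distrib mult_ac)
  have gen': "(fk * fr * (fj * z)) * (E / G) * (pc * pt) * (pt / P * Q) * (q / (f * pb) * (n1 * n2 * R / (d1 * d2 * d3 * (fj * fa))))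
     = (E * (q * pt * pc * fr) / (f * (G * P / (fk * pt)) * pb)) * ((n1 * n2 * R * Q / (d1 * d2 * d3)) * (z / fa))"
    if "fj \<noteq> 0" for fk fr fj z G pc pt P q f pb n1 n2 d1 d2 d3 fa :: complex
  proof -
    have "(fk * fr * (fj * z)) * (E / G) * (pc * pt) * (pt / P * Q) * (q / (f * pb) * (n1 * n2 * R / (d1 * d2 * d3 * (fj * fa))))
     = (E * (q * pt * pc * fr) / (f * (G * P / (fk * pt)) * pb)) * ((n1 * n2 * R * Q / (d1 * d2 * d3)) * (z / fa))
        * (fj * inverse fj)"
      by (simp only: divide_inverse inverse_mult_distrib inverse_inverse_eq mult_ac)
    also have "fj * inverse fj = 1" using that by simp
    finally show ?thesis by (simp only: mult_1_right)
  qed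
  have "\<rho> ^ N * (\<i> ^ N * (- \<i>) ^ k * (E / Gamma (2 * \<tau>)) * (pochhammer (2 * c) k * pochhammer \<tau> k)
      * (pochhammer s N / (fact N * pochhammer (2 * b) N)
         * (of_nat (N choose k) * pochhammer (of_nat N + 2 * s - 1) k * pochhammer \<tau> k
            / (pochhammer s k * pochhammer (2 * \<tau>) (2 * k)))
         * watson_sum (s + of_nat k) (\<tau> + of_nat k) (N - k)))
    = (\<rho> ^ N * (-1) ^ j) * (E / Gamma (2 * \<tau>)) * (pochhammer (2 * c) k * pochhammer \<tau> k)
      * (pochhammer \<tau> k / pochhammer (2 * \<tau>) (2 * k) * Q)
      * (pochhammer s N / (fact N * pochhammer (2 * b) N)
         * (of_nat (N choose k) * pochhammer (of_nat N + 2 * s - 1) k / pochhammer s k)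
         * (pochhammer (1/2) j / pochhammer (s + of_nat k) j))"
    unfolding W i by (rule gen)
  also have "\<dots> = (4 ^ k * (\<rho> / 4) ^ k * (4 ^ j * (- (\<rho>\<^sup>2 / 4)) ^ j))
      * (E / Gamma (2 * \<tau>)) * (pochhammer (2 * c) k * pochhammer \<tau> k)
      * (pochhammer \<tau> k / pochhammer (2 * \<tau>) (2 * k) * Q)
      * (pochhammer (of_nat k + 2 * s - 1) k / (fact k * pochhammer (2 * b) k)
         * (pochhammer ((s + of_nat k) / 2) j * pochhammer ((s + of_nat k + 1) / 2) j * R
            / (pochhammer (s + of_nat k / 2) j * pochhammer (b + of_nat k / 2) j * pochhammer (b + (of_nat k + 1) / 2) j
               * (4 ^ j * fact j))))"
    unfolding r hahn_coefficient_pochhammer_identity[OF s b2, of k j, folded N_def R_def] by (rule refl)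
  also have "\<dots> = (E * (pochhammer (of_nat k + 2 * s - 1) k * pochhammer \<tau> k * pochhammer (2 * c) k * (\<rho> / 4) ^ k)
        / (fact k * degen_factor k (2 * a + 2 * c - 1) * pochhammer (2 * b) k))
      * ((pochhammer ((s + of_nat k) / 2) j * pochhammer ((s + of_nat k + 1) / 2) j * R * Q
            / (pochhammer (s + of_nat k / 2) j * pochhammer (b + of_nat k / 2) j * pochhammer (b + (of_nat k + 1) / 2) j))
         * ((- (\<rho>\<^sup>2 / 4)) ^ j / fact j))"
    unfolding D by (rule gen') simp
  also have "pochhammer ((s + of_nat k) / 2) j * pochhammer ((s + of_nat k + 1) / 2) j * R * Q
            / (pochhammer (s + of_nat k / 2) j * pochhammer (b + of_nat k / 2) j * pochhammer (b + (of_nat k + 1) / 2) j)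
      = prod_list (map (\<lambda>a. pochhammer a j) as) / prod_list (map (\<lambda>b. pochhammer b j) bs)"
  proof (cases "k = 0")
    case True
    have "n1 * n2 * 1 * (y / z) / (d1 * d2 * d3) = n1 * (n2 * (y * 1)) / (d1 * (d2 * (d3 * (z * 1))))"
      for n1 n2 y z d1 d2 d3 :: complex
      by (simp only: divide_inverse inverse_mult_distrib mult_ac mult_1_left mult_1_right)
    then show ?thesis
      unfolding as_def bs_def R_def Q_def s_def \<tau>_def
      by (simp only: True simp_thms if_True append.simps list.map prod_list.Cons prod_list.Nil)
  next
    case False
    have "n1 * n2 * (r / r') * (y / z) / (d1 * d2 * d3) = n1 * (n2 * (r * (y * 1))) / (r' * (d1 * (d2 * (d3 * (z * 1)))))"
      for n1 n2 r r' y z d1 d2 d3 :: complex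
      by (simp only: divide_inverse inverse_mult_distrib mult_ac mult_1_left mult_1_right)
    then show ?thesis
      unfolding as_def bs_def R_def Q_def s_def \<tau>_def
      by (simp only: False simp_thms if_False append.simps list.map prod_list.Cons prod_list.Nil)
  qed
  finally show ?thesis
    unfolding q unfolding E_def s_def \<tau>_def
    by (simp only: mult.assoc times_divide_eq_right times_divide_eq_left)
qed

section \<open>The integral for real parameters\<close>

lemma hahn_integral_real_parameters:
  fixes A B C :: real and \<rho> :: complex and k :: nat
  assumes A: "A > 0" and B: "B > 0" and C: "C > 0"
  shows "has_bochner_integral lborel
    (\<lambda>x::real.
       hypergeo [of_real A + \<i> * of_real x] [2 * of_real A] (- \<i> * \<rho>)
       * hypergeo [of_real B - \<i> * of_real x] [2 * of_real B] (\<i> * \<rho>)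
       * hahn_weight A C x * cont_hahn k (of_real x) (of_real A) (of_real C))
    (2 * pi * (Gamma (2 * of_real A) * Gamma (of_real A + of_real C) ^ 2 * Gamma (2 * of_real C)
          * pochhammer (of_nat k + 2 * of_real A + 2 * of_real B - 1) k
          * pochhammer (of_real A + of_real C) k * pochhammer (2 * of_real C) k * (\<rho> / 4) ^ k)
        / (fact k * degen_factor k (2 * of_real A + 2 * of_real C - 1) * pochhammer (2 * of_real B) k)
      * hypergeo_4F5 k (of_real A) (of_real B) (of_real C) (- (\<rho>\<^sup>2 / 4)))"
proof -
  define a b c where "a = complex_of_real A" and "b = complex_of_real B" and "c = complex_of_real C"
  define V where "V = (\<lambda>N. \<i> ^ N * (- \<i>) ^ k
      * (2 * pi * (Gamma (2 * a) * Gamma (a + c) ^ 2 * Gamma (2 * c) / Gamma (2 * (a + c))))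
      * (pochhammer (2 * c) k * pochhammer (a + c) k)
      * (pochhammer (a + b) N / (fact N * pochhammer (2 * b) N)
         * (of_nat (N choose k) * pochhammer (of_nat N + 2 * (a + b) - 1) k * pochhammer (a + c) k
            / (pochhammer (a + b) k * pochhammer (2 * (a + c)) (2 * k)))
         * watson_sum (a + b + of_nat k) (a + c + of_nat k) (N - k)))"
  define f where "f = (\<lambda>N x. \<rho> ^ N * (hahn_weight A C x * hahn_genfun_coeff A B x N * cont_hahn k (of_real x) a c))"
  define F where "F = (\<lambda>x::real. hypergeo [a + \<i> * of_real x] [2 * a] (- \<i> * \<rho>)
       * hypergeo [b - \<i> * of_real x] [2 * b] (\<i> * \<rho>) * hahn_weight A C x * cont_hahn k (of_real x) a c)"
  define L where "L = norm \<rho> * max 1 (A / (2 * A))"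
  define L' where "L' = norm \<rho> * (max 1 (B / C) * max 1 (C / (2 * B)))"
  define coef where "coef = (\<lambda>N. Gamma A * Gamma C * (\<Sum>m\<le>N. (L ^ m / fact m) * (L' ^ (N - m) / fact (N - m))))"
  \<comment> \<open>The half of the weight that \<open>norm_hahn_genfun_coeff_le\<close> leaves
    over, together with p_k.\<close>
  define U where "U = (\<lambda>x. norm (Gamma (of_real A - \<i> * of_real x) * Gamma (of_real C + \<i> * of_real x)
      * cont_hahn k (of_real x) (of_real A) (of_real C)))"
  have f_int: "has_bochner_integral lborel (f N) (\<rho> ^ N * V N)" for N
    unfolding f_def V_def a_def b_def c_def
    by (intro has_bochner_integral_mult_right hahn_genfun_coeff_integral A B C)
  have bound: "norm (f N x) \<le> coef N * U x" for N x
  proof -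
    have "f N x = (\<rho> ^ N * hahn_genfun_coeff A B x N
          * (Gamma (of_real A + \<i> * of_real x) * Gamma (of_real C - \<i> * of_real x)))
        * (Gamma (of_real A - \<i> * of_real x) * Gamma (of_real C + \<i> * of_real x) * cont_hahn k (of_real x) a c)"
      by (simp add: f_def hahn_weight_def mult_ac)
    then show ?thesis
      using mult_right_mono[OF norm_hahn_genfun_coeff_le[OF A B C, of \<rho> N x], of "U x"]
      by (simp add: norm_mult U_def coef_def L_def L'_def a_def c_def)
  qed
  have "summable (\<lambda>N. \<Sum>m\<le>N. (L ^ m / fact m) * (L' ^ (N - m) / fact (N - m)))"
  proof (rule summable_Cauchy_product)
    have "L \<ge> 0" "L' \<ge> 0" by (simp_all add: L_def L'_def)
    then show "summable (\<lambda>m. norm (L ^ m / fact m))" "summable (\<lambda>m. norm (L' ^ m / fact m))"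
      using summable_power_over_fact by simp_all
  qed
  then have coef: "summable coef"
    unfolding coef_def by (rule summable_mult)
  have U: "integrable lborel U"
    unfolding U_def by (rule integrable_Gamma_Gamma_cont_hahn) fact+
  have F: "(\<lambda>N. f N x) sums F x" for x
    using sums_mult2[OF hahn_genfun_sums[OF A B, of \<rho> x], of "hahn_weight A C x * cont_hahn k (of_real x) a c"]
    by (simp add: f_def F_def a_def b_def mult_ac)
  note exchange = has_bochner_integral_sums[OF f_int bound U coef F]
  define K where "K = 2 * pi * (Gamma (2 * a) * Gamma (a + c) ^ 2 * Gamma (2 * c)
          * pochhammer (of_nat k + 2 * a + 2 * b - 1) k * pochhammer (a + c) k * pochhammer (2 * c) k * (\<rho> / 4) ^ k)
        / (fact k * degen_factor k (2 * a + 2 * c - 1) * pochhammer (2 * b) k)"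
  define t where "t = (\<lambda>j. prod_list (map (\<lambda>a. pochhammer a j) ([(a + b + of_nat k) / 2, (a + b + of_nat k + 1) / 2]
        @ (if k = 0 then [] else [a + b + of_nat k - 1/2]) @ [b - c]))
      / prod_list (map (\<lambda>b. pochhammer b j) ((if k = 0 then [] else [a + b + (of_nat k - 1) / 2])
        @ [a + b + of_nat k / 2, b + of_nat k / 2, b + (of_nat k + 1) / 2, a + c + of_nat k + 1/2]))
         * ((- (\<rho>\<^sup>2 / 4)) ^ j / fact j))"
  have even_terms: "\<rho> ^ (k + 2 * j) * V (k + 2 * j) = K * t j" for j
    unfolding V_def K_def t_def a_def b_def c_def by (rule hahn_coefficient_term) fact+
  \<comment> \<open>For N < k the binomial coefficient vanishes; for N - k odd, Watson's sum
    does.\<close>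
  have other_terms: "\<rho> ^ N * V N = 0" if "N \<notin> range (\<lambda>j. k + 2 * j)" for N
  proof (cases "N < k")
    case True
    then show ?thesis by (simp add: V_def binomial_eq_0)
  next
    case False
    have "odd (N - k)"
    proof
      assume "even (N - k)"
      then obtain j where "N - k = 2 * j" by (elim evenE)
      with False have "N = k + 2 * j" by simp
      with that show False by blast
    qed
    then obtain j where j: "N - k = 2 * j + 1" by (elim oddE)
    have np: "2 * (a + b + of_nat k) \<notin> \<int>\<^sub>\<le>\<^sub>0" "a + b + of_nat k \<notin> \<int>\<^sub>\<le>\<^sub>0" "2 * (a + c + of_nat k) \<notin> \<int>\<^sub>\<le>\<^sub>0"
      using notin_nonpos_Ints_of_real[of "2 * (A + B + real k)"] notin_nonpos_Ints_of_real[of "A + B + real k"]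
        notin_nonpos_Ints_of_real[of "2 * (A + C + real k)"] A B C
      by (simp_all add: a_def b_def c_def)
    show ?thesis
      unfolding V_def j by (simp only: watson_sum_odd_even(1)[OF np] mult_zero_right)
  qed
  have "(\<lambda>N. \<rho> ^ N * V N) sums (\<Sum>N. \<rho> ^ N * V N)"
    using exchange(1) by (rule summable_sums)
  then have "(\<lambda>j. \<rho> ^ (k + 2 * j) * V (k + 2 * j)) sums (\<Sum>N. \<rho> ^ N * V N)"
    by (subst sums_mono_reindex[of "\<lambda>j. k + 2 * j"]) (auto simp: strict_mono_def other_terms)
  then have "(\<lambda>j. K * t j) sums (\<Sum>N. \<rho> ^ N * V N)"
    by (simp only: even_terms)
  then have "(\<Sum>N. \<rho> ^ N * V N) = K * suminf t"
    by (rule sums_mult_imp_eq_mult_suminf)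
  also have "suminf t = hypergeo_4F5 k a b c (- (\<rho>\<^sup>2 / 4))"
    by (simp only: hypergeo_4F5_def hypergeo_def t_def)
  finally show ?thesis
    using exchange(2) unfolding F_def K_def a_def b_def c_def by simp
qed

theorem corollary6p6:
  fixes k :: nat and \<rho> a b c :: complex
  assumes "Re a > 0" and "Re b > 0" and "Re c > 0"
    and "Im a = Im b" and "Im b = Im c"
  shows "has_bochner_integral lborel
    (\<lambda>x::real.
       hypergeo [a + \<i> * of_real x] [2 * of_real (Re a)] (- \<i> * \<rho>)
       * hypergeo [cnj b - \<i> * of_real x] [2 * of_real (Re b)] (\<i> * \<rho>)
       * Gamma (a + \<i> * of_real x) * Gamma (c + \<i> * of_real x)
       * Gamma (cnj a - \<i> * of_real x) * Gamma (cnj c - \<i> * of_real x)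
       * cont_hahn k (of_real x) a c)
    (2 * of_real pi
       * (Gamma (2 * of_real (Re a)) * Gamma (a + cnj c) ^ 2 * Gamma (2 * of_real (Re c))
          * pochhammer (of_nat k + 2 * of_real (Re a) + 2 * of_real (Re b) - 1) k
          * pochhammer (a + cnj c) k * pochhammer (2 * of_real (Re c)) k * (\<rho> / 4) ^ k)
       / (fact k
          * degen_factor k (2 * of_real (Re a) + 2 * of_real (Re c) - 1)
          * pochhammer (2 * of_real (Re b)) k)
       * hypergeo_4F5 k (of_real (Re a)) (of_real (Re b)) (of_real (Re c)) (- (\<rho>\<^sup>2 / 4)))"
proof -
  \<comment> \<open>The common imaginary part is absorbed by the translation of x by \<eta>, under
    which Lebesgue measure is invariant.\<close>
  define \<eta> where "\<eta> = Im a"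
  have a: "a = of_real (Re a) + \<i> * of_real \<eta>" and b: "cnj b = of_real (Re b) - \<i> * of_real \<eta>"
    and c: "c = of_real (Re c) + \<i> * of_real \<eta>"
    and ca: "cnj a = of_real (Re a) - \<i> * of_real \<eta>" and cc: "cnj c = of_real (Re c) - \<i> * of_real \<eta>"
    using assms(4,5) by (simp_all add: \<eta>_def complex_eq_iff)
  have ac: "a + cnj c = of_real (Re a) + of_real (Re c)"
    using assms(4,5) by (simp add: complex_eq_iff)
  \<comment> \<open>The redundant factor in \<open>\<eta> + 1 * x\<close> matches the affine
    substitution rule with slope 1.\<close>
  have shift: "a + \<i> * of_real x = of_real (Re a) + \<i> * of_real (\<eta> + 1 * x)"
      "c + \<i> * of_real x = of_real (Re c) + \<i> * of_real (\<eta> + 1 * x)"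
      "cnj a - \<i> * of_real x = of_real (Re a) - \<i> * of_real (\<eta> + 1 * x)"
      "cnj b - \<i> * of_real x = of_real (Re b) - \<i> * of_real (\<eta> + 1 * x)"
      "cnj c - \<i> * of_real x = of_real (Re c) - \<i> * of_real (\<eta> + 1 * x)" for x :: real
    by (subst a c ca b cc; simp add: algebra_simps)+
  \<comment> \<open>In the sum form x enters only through a + i x, which the translation
    preserves.\<close>
  have hahn: "cont_hahn k (of_real x) a c = cont_hahn k (of_real (\<eta> + 1 * x)) (of_real (Re a)) (of_real (Re c))" for x :: real
    using assms(4,5) by (subst (1 2) cont_hahn_eq_sum[of _ "Re a" _ "Re c"]) (simp_all add: shift(1))
  show ?thesis
    using lborel_has_bochner_integral_real_affine_iff[THEN iffD1,
        OF _ hahn_integral_real_parameters[OF assms(1-3), where k = k and \<rho> = \<rho>], of 1 \<eta>]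
    unfolding shift hahn ac by (simp add: hahn_weight_def mult.assoc)
qed

end
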